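(* Let $M$ be a lattice and let $\Delta\subset M_{\mathbb{R}}$ be a lattice simplex with the integer decomposition property. If the normalized volume $\operatorname{Vol}(\Delta)$ is a prime number, then the $h^*$-vector of $\Delta$ is unimodal.
   Context: A lattice $M$ is a free abelian group of finite rank, and $M_{\mathbb{R}}=M\otimes_{\mathbb{Z}}\mathbb{R}$. A lattice polytope $P\subset M_{\mathbb{R}}$ is the convex hull of a finite set of points of $M$; a $d$-dimensional lattice polytope with exactly $d+1$ vertices is a ($d$-dimensional) lattice simplex. Polytopes need not be full-dimensional. Integer decomposition property (IDP): for every positive integer $n$, every point $z\in nP\cap M$ can be written $z=z_1+\cdots+z_n$ with all $z_i\in P\cap M$. Normalized volume: for a $d$-dimensional lattice polytope $P$ and $v\in P\cap M$, put $M_P=M\cap\operatorname{span}_{\mathbb{R}}(P-v)$ (independent of $v$). $\operatorname{Vol}(P)$ is $d!$ times the $d$-dimensional volume of $P-v$ in $\operatorname{span}_{\mathbb{R}}(P-v)$, normalized so that a fundamental parallelepiped of $M_P$ has volume one. A single lattice point has normalized volume one. $h^*$-vector: for a $d$-dimensional lattice polytope $P$, $$\sum_{n\ge 0}|nP\cap M|\,t^n=\frac{h^*_P(t)}{(1-t)^{d+1}},\qquad h_P^*(t)=\sum_{i=0}^d h_i^*(P)t^i;$$ the $h^*$-vector is $(h_0^*(P),\dots,h_d^*(P))$ (terminal zeros retained). A finite sequence $(a_0,\dots,a_d)$ is unimodal if there is $k$ with $a_0\le\cdots\le a_k\ge\cdots\ge a_d$. *)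

theory Defs
  imports "HOL-Analysis.Analysis" "HOL-Computational_Algebra.Formal_Power_Series"
begin

text \<open>A free abelian group \<open>M\<close> of finite rank, together with \<open>M \<otimes> \<real>\<close>, is realised as the
  integer span of a linearly independent finite subset \<open>B\<close> of a Euclidean space, with
  \<open>M \<otimes> \<real> = span B = span M\<close>.  The set \<open>B\<close> need not span the ambient space; in particular
  \<open>B = {}\<close> is the lattice of rank 0.  The ambient inner product plays no role.\<close>

definition lattice_basis :: "'a::euclidean_space set \<Rightarrow> 'a set \<Rightarrow> bool" where
  "lattice_basis B M \<longleftrightarrow> finite B \<and> independent B \<and>
     M = {(\<Sum>b\<in>B. of_int (c b) *\<^sub>R b) | c :: 'a \<Rightarrow> int. True}"

definition is_lattice :: "'a::euclidean_space set \<Rightarrow> bool" where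
  "is_lattice M \<longleftrightarrow> (\<exists>B. lattice_basis B M)"

definition lattice_polytope :: "'a::euclidean_space set \<Rightarrow> 'a set \<Rightarrow> bool" where
  "lattice_polytope M P \<longleftrightarrow> (\<exists>V. finite V \<and> V \<noteq> {} \<and> V \<subseteq> M \<and> P = convex hull V)"

definition lattice_simplex :: "'a::euclidean_space set \<Rightarrow> 'a set \<Rightarrow> bool" where
  "lattice_simplex M P \<longleftrightarrow>
     lattice_polytope M P \<and> int (card {v. v extreme_point_of P}) = aff_dim P + 1"

definition dilate :: "nat \<Rightarrow> 'a::euclidean_space set \<Rightarrow> 'a set" where
  "dilate n P = (\<lambda>x. real n *\<^sub>R x) ` P"

definition IDP :: "'a::euclidean_space set \<Rightarrow> 'a set \<Rightarrow> bool" where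
  "IDP M P \<longleftrightarrow> (\<forall>n\<ge>1. \<forall>z \<in> dilate n P \<inter> M.
     \<exists>w :: nat \<Rightarrow> 'a. (\<forall>i\<in>{1..n}. w i \<in> P \<inter> M) \<and> z = (\<Sum>i=1..n. w i))"

definition sublattice_at :: "'a::euclidean_space set \<Rightarrow> 'a set \<Rightarrow> 'a \<Rightarrow> 'a set" where
  "sublattice_at M P v = M \<inter> span ((\<lambda>x. x - v) ` P)"

text \<open>The volume of \<open>P - v\<close> is taken in the coordinates given by a basis \<open>B\<close> of the lattice
  \<open>M\<^sub>P\<close>, which gives the fundamental parallelepiped of \<open>B\<close> volume one.  The value does not depend
  on the choice of \<open>v\<close> and \<open>B\<close>.  For a lattice point, \<open>B = {}\<close> and the product measure over the
  empty index set has total mass one.\<close>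

definition normalized_volume :: "'a::euclidean_space set \<Rightarrow> 'a set \<Rightarrow> real" where
  "normalized_volume M P =
     (let v = (SOME v. v \<in> P \<inter> M);
          B = (SOME B. lattice_basis B (sublattice_at M P v))
      in fact (nat (aff_dim P)) *
         measure (Pi\<^sub>M B (\<lambda>_. lborel :: real measure))
           {x \<in> B \<rightarrow>\<^sub>E UNIV. (\<Sum>b\<in>B. x b *\<^sub>R b) \<in> (\<lambda>y. y - v) ` P})"

definition ehrhart_series :: "'a::euclidean_space set \<Rightarrow> 'a set \<Rightarrow> int fps" where
  "ehrhart_series M P = Abs_fps (\<lambda>n. int (card (dilate n P \<inter> M)))"

text \<open>The defining identity \<open>\<Sum> |nP \<inter> M| t\<^sup>n = h\<^sup>*(t) / (1 - t)\<^sup>d\<^sup>+\<^sup>1\<close>, cleared of denominators.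
  The vector lists the coefficients of \<open>t\<^sup>0, \<dots>, t\<^sup>d\<close>, zeros included.\<close>

definition h_star_series :: "'a::euclidean_space set \<Rightarrow> 'a set \<Rightarrow> int fps" where
  "h_star_series M P = ehrhart_series M P * (1 - fps_X) ^ (nat (aff_dim P) + 1)"

definition h_star_vector :: "'a::euclidean_space set \<Rightarrow> 'a set \<Rightarrow> int list" where
  "h_star_vector M P = map (\<lambda>i. fps_nth (h_star_series M P) i) [0..<nat (aff_dim P) + 1]"

definition unimodal :: "int list \<Rightarrow> bool" where
  "unimodal a \<longleftrightarrow> (\<exists>k<length a. sorted_wrt (\<le>) (take (Suc k) a) \<and> sorted_wrt (\<ge>) (drop k a))"

end

theory Submission
  imports Defs "HOL-Library.Poly_Mapping" "HOL-Library.Z2" "HOL-Real_Asymp.Real_Asymp"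
begin

text \<open>Let \<open>h k\<close> be the number of lattice points of height \<open>k\<close> in the half-open fundamental
  parallelepiped of the cone over the simplex; the \<open>h\<^sup>*\<close>-vector consists of these numbers and they add
  up to the normalized volume \<open>p\<close>.  Modulo the lattice spanned by the lifted vertices these points form
  a group of order \<open>p\<close>.  As \<open>p\<close> is prime, all nonzero points have nonzero coordinates at the same \<open>m\<close>
  vertices, and \<open>x \<mapsto> 1 - x\<close> shows \<open>h k = h (m - k)\<close>.  What remains is \<open>h k \<le> h (k + 1)\<close> for
  \<open>2 (k + 1) \<le> m\<close>.

  This is proved by the characteristic 2 anisotropy technique (Papadakis and Petrotou; Adiprasito,
  Papadakis, Petrotou and Steinmeyer), made explicit for simplices.  The semigroup ring of the cone is
  reduced modulo the generic parameters \<open>y - \<tau> \<Sum>\<^sub>s a(y,s) x\<^sup>s\<close>, one for each vertex \<open>y\<close>, where \<open>s\<close> runs over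
  the nonvertex points of height 1; the coefficients of \<open>\<Omega> = \<Prod>\<^sub>y (1 - \<tau> \<Sum>\<^sub>s a(y,s) x\<^sup>s\<^sup>-\<^sup>y)\<inverse>\<close> are the
  values of the degree map.  If \<open>h (k + 1) < h k\<close>, some nonzero \<open>f\<close> of degree \<open>k\<close> is annihilated by a
  generic linear form.  The degree map then vanishes on the products of \<open>f\<^sup>2\<close> with that form, and a
  Frobenius splitting, under which \<open>\<Omega>\<close> is an eigenvector, extracts the square root of this relation:
  the degree map vanishes on all multiples of \<open>f\<close> (integral decomposition is used here), so \<open>f = 0\<close>.\<close>

section \<open>Power series over the field with two elements\<close>

text \<open>The terms at \<open>(z, z')\<close> and \<open>(z', z)\<close> cancel, so only the
  diagonal is left. Every later use of squares being additive comes from this.\<close>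

lemma sum_symmetric_char_2:
  fixes h :: "'i \<Rightarrow> 'i \<Rightarrow> 'r::comm_monoid_add"
  assumes "finite Z" and two: "\<And>x::'r. x + x = 0"
    and sym: "\<And>z z'. z \<in> Z \<Longrightarrow> z' \<in> Z \<Longrightarrow> h z z' = h z' z"
  shows "(\<Sum>z\<in>Z. \<Sum>z'\<in>Z. h z z') = (\<Sum>z\<in>Z. h z z)"
  using assms(1) sym
proof (induction Z rule: finite_induct)
  case (insert a Z)
  have "(\<Sum>z\<in>insert a Z. \<Sum>z'\<in>insert a Z. h z z')
      = h a a + (\<Sum>z\<in>Z. h a z) + ((\<Sum>z\<in>Z. h z a) + (\<Sum>z\<in>Z. \<Sum>z'\<in>Z. h z z'))"
    using insert.hyps by (simp add: sum.distrib ac_simps)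
  also have "(\<Sum>z\<in>Z. h z a) = (\<Sum>z\<in>Z. h a z)"
    using insert.prems by (intro sum.cong) auto
  also have "(\<Sum>z\<in>Z. \<Sum>z'\<in>Z. h z z') = (\<Sum>z\<in>Z. h z z)"
    using insert by auto
  also have "h a a + (\<Sum>z\<in>Z. h a z) + ((\<Sum>z\<in>Z. h a z) + (\<Sum>z\<in>Z. h z z))
      = h a a + ((\<Sum>z\<in>Z. h a z) + (\<Sum>z\<in>Z. h a z)) + (\<Sum>z\<in>Z. h z z)"
    by (simp add: add.assoc)
  finally show ?case
    using insert.hyps two by simp
qed simp

text \<open>Gaussian elimination without division, for fewer equations than unknowns: the solution
  stays inside the ring, so no fraction field is formed.\<close>

lemma exists_kernel_vector:
  fixes a :: "'y \<Rightarrow> 'z \<Rightarrow> 'r::idom"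
  assumes "finite Y" "finite Z" "card Y < card Z"
  shows "\<exists>f. (\<exists>z\<in>Z. f z \<noteq> 0) \<and> (\<forall>y\<in>Y. (\<Sum>z\<in>Z. a y z * f z) = 0)"
  using assms
proof (induction Y arbitrary: Z a rule: finite_induct)
  case empty
  then obtain z where "z \<in> Z"
    by fastforce
  then show ?case
    by (intro exI[of _ "\<lambda>_. 1"]) auto
next
  case (insert y Y)
  show ?case
  proof (cases "\<forall>z\<in>Z. a y z = 0")
    case True
    then show ?thesis
      using insert.IH[of Z a] insert.prems insert.hyps by auto
  next
    case False
    then obtain z0 where z0: "z0 \<in> Z" "a y z0 \<noteq> 0"
      by blast
    define Z' where "Z' = Z - {z0}"
    have Z: "Z = insert z0 Z'" "z0 \<notin> Z'" "finite Z'" "card Y < card Z'"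
      using z0 insert.prems insert.hyps by (auto simp: Z'_def)
    obtain f where f: "\<exists>z\<in>Z'. f z \<noteq> 0"
      "\<forall>y'\<in>Y. (\<Sum>z\<in>Z'. (a y z0 * a y' z - a y z * a y' z0) * f z) = 0"
      using insert.IH[of Z' "\<lambda>y' z. a y z0 * a y' z - a y z * a y' z0"] Z by auto
    \<comment> \<open>Back substitution for the pivot \<open>a y z0\<close>: the other entries are
      multiplied by it so that the entry at \<open>z0\<close> needs no division.\<close>
    define f' where "f' z = (if z = z0 then - (\<Sum>z\<in>Z'. a y z * f z) else a y z0 * f z)" for z
    have s: "(\<Sum>z\<in>Z. a y' z * f' z)
        = - a y' z0 * (\<Sum>z\<in>Z'. a y z * f z) + (\<Sum>z\<in>Z'. a y' z * (a y z0 * f z))" for y'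
    proof -
      have "(\<Sum>z\<in>Z'. a y' z * f' z) = (\<Sum>z\<in>Z'. a y' z * (a y z0 * f z))"
        using Z(2) by (intro sum.cong) (auto simp: f'_def)
      then show ?thesis
        using Z by (simp add: f'_def)
    qed
    have "(\<Sum>z\<in>Z. a y' z * f' z) = 0" if "y' \<in> insert y Y" for y'
    proof (cases "y' = y")
      case True
      then show ?thesis
        unfolding True s by (simp add: sum_distrib_left mult.left_commute sum_negf)
    next
      case False
      then have "(\<Sum>z\<in>Z'. (a y z0 * a y' z - a y z * a y' z0) * f z) = 0"
        using f(2) that by auto
      then show ?thesis
        unfolding s by (simp add: sum_distrib_left left_diff_distrib sum_subtractf mult.assoc mult.left_commute mult.commute[of _ "a y _"] sum_negf)
    qed
    moreover have "\<exists>z\<in>Z. f' z \<noteq> 0"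
      using f(1) z0 Z by (auto simp: f'_def)
    ultimately show ?thesis
      by blast
  qed
qed

text \<open>Exponent vectors, polynomials over the field with two elements in variables numbered by
  \<open>nat\<close>, and power series in \<tau> over these. The last form an integral domain, as
  \<open>exists_kernel_vector\<close> demands.\<close>

type_synonym mono = "nat \<Rightarrow>\<^sub>0 nat"
type_synonym bpoly = "mono \<Rightarrow>\<^sub>0 bit"
type_synonym bser = "bpoly fps"

abbreviation lk :: "('a \<Rightarrow>\<^sub>0 'b::zero) \<Rightarrow> 'a \<Rightarrow> 'b" where "lk \<equiv> Poly_Mapping.lookup"

lemma bit_double: "b + b = (0::bit)"
  by (cases b) auto

lemma bpoly_double: "x + x = (0::bpoly)"
  by (rule poly_mapping_eqI) (simp only: lookup_add bit_double lookup_zero)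

lemma bser_double: "x + x = (0::bser)"
  by (rule fps_ext) (simp only: fps_add_nth bpoly_double fps_zero_nth)

lemma lookup_single_mult:
  fixes N :: "'a::cancel_comm_monoid_add" and f :: "'a \<Rightarrow>\<^sub>0 'b::comm_semiring_0"
  shows "lk (Poly_Mapping.single N b * f) (N + K) = b * lk f K"
    and "(\<And>K. L \<noteq> N + K) \<Longrightarrow> lk (Poly_Mapping.single N b * f) L = 0"
proof -
  have *: "lk (Poly_Mapping.single N b * f) L = b * Sum_any (\<lambda>q. lk f q when L = N + q)" for L
    by (simp add: lookup_mult lookup_single when_mult)
  have "Sum_any (\<lambda>q. lk f q when N + K = N + q) = lk f K"
    using Sum_any_when_equal'[of "lk f" K] by simp
  then show "lk (Poly_Mapping.single N b * f) (N + K) = b * lk f K"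
    by (simp add: *)
  show "lk (Poly_Mapping.single N b * f) L = 0" if "\<And>K. L \<noteq> N + K"
    using that by (simp add: *)
qed

lemma poly_mapping_sum_single: "(f :: 'a \<Rightarrow>\<^sub>0 'b::comm_monoid_add) = (\<Sum>N\<in>Poly_Mapping.keys f. Poly_Mapping.single N (lk f N))"
proof (rule poly_mapping_eqI)
  fix k
  have "lk (\<Sum>N\<in>Poly_Mapping.keys f. Poly_Mapping.single N (lk f N)) k
      = (\<Sum>N\<in>Poly_Mapping.keys f. if N = k then lk f N else 0)"
    by (simp add: lookup_sum lookup_single when_def)
  then show "lk f k = lk (\<Sum>N\<in>Poly_Mapping.keys f. Poly_Mapping.single N (lk f N)) k"
    by (simp add: in_keys_iff)
qed

section \<open>Cartier operators: extraction of square roots\<close>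

lemma mono_halve_unique: "M + M = N + N \<Longrightarrow> M = (N :: mono)"
proof (rule poly_mapping_eqI)
  fix i
  assume "M + M = N + N"
  from arg_cong[OF this, of "\<lambda>x. lk x i"] show "lk M i = lk N i"
    by (simp add: lookup_add)
qed

lemma inj_double_add: "inj (\<lambda>M :: mono. M + M + e)"
  by (rule injI) (auto intro: mono_halve_unique)

text \<open>A Cartier operator: it keeps the monomials that are the monomial of \<open>e\<close>
  times a square and takes the root of the square. The coefficients 0 and 1 are their own square
  roots.\<close>

definition cartier_poly :: "mono \<Rightarrow> bpoly \<Rightarrow> bpoly" where
  "cartier_poly e f = Poly_Mapping.map_key (\<lambda>M. M + M + e) f"

lemma lookup_cartier_poly: "lk (cartier_poly e f) M = lk f (M + M + e)"
  unfolding cartier_poly_def by (subst map_key.rep_eq[OF inj_double_add]) simp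

lemma cartier_poly_add: "cartier_poly e (f + g) = cartier_poly e f + cartier_poly e g"
  by (rule poly_mapping_eqI) (simp add: lookup_cartier_poly lookup_add)

lemma cartier_poly_0 [simp]: "cartier_poly e 0 = 0"
  by (rule poly_mapping_eqI) (simp add: lookup_cartier_poly)

lemma cartier_poly_sum: "cartier_poly e (\<Sum>i\<in>I. f i) = (\<Sum>i\<in>I. cartier_poly e (f i))"
  by (induction I rule: infinite_finite_induct) (auto simp: cartier_poly_add)

lemma bpoly_square: "r * r = (\<Sum>N\<in>Poly_Mapping.keys r. Poly_Mapping.single (N + N) (lk r N) :: bpoly)"
proof -
  have bb: "b * b = b" for b :: bit
    by (cases b) simp_all
  have "r * r = (\<Sum>N\<in>Poly_Mapping.keys r. Poly_Mapping.single N (lk r N)) * (\<Sum>N\<in>Poly_Mapping.keys r. Poly_Mapping.single N (lk r N))"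
    by (rule arg_cong2[of _ _ _ _ times]) (rule poly_mapping_sum_single)+
  also have "\<dots> = (\<Sum>N\<in>Poly_Mapping.keys r. \<Sum>N'\<in>Poly_Mapping.keys r.
      Poly_Mapping.single N (lk r N) * Poly_Mapping.single N' (lk r N'))"
    by (rule sum_product)
  also have "\<dots> = (\<Sum>N\<in>Poly_Mapping.keys r. Poly_Mapping.single N (lk r N) * Poly_Mapping.single N (lk r N))"
    by (rule sum_symmetric_char_2) (auto simp: bpoly_double mult.commute)
  finally show ?thesis
    by (simp add: mult_single bb)
qed

lemma cartier_poly_square_mult:
  assumes e: "\<And>i. lk e i \<le> 1"
  shows "cartier_poly e (r * r * x) = r * cartier_poly e x"
proof -
  have *: "cartier_poly e (Poly_Mapping.single (N + N) b * x) = Poly_Mapping.single N b * cartier_poly e x" for N b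
  proof (rule poly_mapping_eqI)
    fix M
    show "lk (cartier_poly e (Poly_Mapping.single (N + N) b * x)) M = lk (Poly_Mapping.single N b * cartier_poly e x) M"
    proof (cases "\<exists>L. M = N + L")
      case True
      then obtain L where L: "M = N + L"
        by blast
      then have "M + M + e = (N + N) + (L + L + e)"
        by (simp add: add_ac)
      then show ?thesis
        by (simp only: lookup_cartier_poly L lookup_single_mult(1))
    next
      case False
      have "M + M + e \<noteq> (N + N) + K" for K
      proof
        assume K: "M + M + e = (N + N) + K"
        \<comment> \<open>From 2 N_i at most 2 M_i + 1 it follows that N_i is at most M_i; a larger
          exponent in \<open>e\<close> would destroy this.\<close>
        have "lk N i \<le> lk M i" for i
          using arg_cong[OF K, of "\<lambda>x. lk x i"] e[of i] by (simp add: lookup_add)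
        then have "M = N + (M - N)"
          by (intro poly_mapping_eqI) (simp add: lookup_add lookup_minus)
        then show False
          using False by blast
      qed
      then show ?thesis
        using False by (simp add: lookup_cartier_poly lookup_single_mult(2))
    qed
  qed
  have "cartier_poly e (r * r * x) = (\<Sum>N\<in>Poly_Mapping.keys r. cartier_poly e (Poly_Mapping.single (N + N) (lk r N) * x))"
    by (simp add: bpoly_square sum_distrib_right cartier_poly_sum)
  also have "\<dots> = (\<Sum>N\<in>Poly_Mapping.keys r. Poly_Mapping.single N (lk r N)) * cartier_poly e x"
    by (simp add: * sum_distrib_right)
  finally show ?thesis
    using poly_mapping_sum_single[of r] by simp
qed


text \<open>A Frobenius splitting: it is additive and turns a factor \<open>r\<^sup>2\<close> into \<open>r\<close>, but only if
  \<open>t\<close> and all exponents in \<open>e\<close> are at most one.\<close>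

definition cartier :: "mono \<Rightarrow> nat \<Rightarrow> bser \<Rightarrow> bser" where
  "cartier e t F = Abs_fps (\<lambda>n. cartier_poly e (fps_nth F (n + n + t)))"

lemma cartier_add: "cartier e t (F + G) = cartier e t F + cartier e t G"
  by (rule fps_ext) (simp add: cartier_def cartier_poly_add)

lemma cartier_0 [simp]: "cartier e t 0 = 0"
  by (rule fps_ext) (simp add: cartier_def)

lemma cartier_sum: "cartier e t (\<Sum>i\<in>I. f i) = (\<Sum>i\<in>I. cartier e t (f i))"
  by (induction I rule: infinite_finite_induct) (auto simp: cartier_add)

lemma bser_square_nth:
  fixes r :: bser
  shows "fps_nth (r * r) n = (if even n then fps_nth r (n div 2) * fps_nth r (n div 2) else 0)"
proof -
  define h where "h i j = (if i + j = n then fps_nth r i * fps_nth r j else 0)" for i j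
  have "fps_nth (r * r) n = (\<Sum>i\<in>{0..n}. fps_nth r i * fps_nth r (n - i))"
    by (simp add: fps_mult_nth)
  also have "\<dots> = (\<Sum>i\<in>{0..n}. \<Sum>j\<in>{0..n}. h i j)"
  proof (rule sum.cong[OF refl])
    fix i assume i: "i \<in> {0..n}"
    have "(\<Sum>j\<in>{0..n}. h i j) = (\<Sum>j\<in>{0..n}. if j = n - i then fps_nth r i * fps_nth r j else 0)"
      using i by (intro sum.cong) (auto simp: h_def)
    then show "fps_nth r i * fps_nth r (n - i) = (\<Sum>j\<in>{0..n}. h i j)"
      by simp
  qed
  also have "\<dots> = (\<Sum>i\<in>{0..n}. h i i)"
    by (rule sum_symmetric_char_2) (auto simp: h_def bpoly_double add.commute mult.commute)
  also have "\<dots> = (\<Sum>i\<in>{0..n}. if even n \<and> i = n div 2 then fps_nth r i * fps_nth r i else 0)"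
    by (intro sum.cong) (auto simp: h_def)
  also have "\<dots> = (if even n then fps_nth r (n div 2) * fps_nth r (n div 2) else 0)"
    by auto
  finally show ?thesis .
qed

lemma cartier_square_mult:
  assumes e: "\<And>i. lk e i \<le> 1" and t: "t \<le> 1"
  shows "cartier e t (r * r * x) = r * cartier e t x"
proof (rule fps_ext)
  fix n
  define g where "g i = cartier_poly e (fps_nth (r * r) i * fps_nth x (n + n + t - i))" for i
  have "fps_nth (cartier e t (r * r * x)) n = (\<Sum>i\<in>{0..n + n + t}. g i)"
    by (simp add: cartier_def fps_mult_nth[of "r * r"] cartier_poly_sum g_def)
  \<comment> \<open>A square has no odd coefficients, and because of \<open>t \<le> 1\<close> the
    even indices up to \<open>n + n + t\<close> are exactly the doubles of
    \<open>0..n\<close>.\<close>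
  also have "\<dots> = (\<Sum>i\<in>(\<lambda>k. k + k) ` {0..n}. g i)"
  proof (rule sum.mono_neutral_right)
    show "\<forall>i\<in>{0..n + n + t} - (\<lambda>k. k + k) ` {0..n}. g i = 0"
    proof
      fix i
      assume i: "i \<in> {0..n + n + t} - (\<lambda>k. k + k) ` {0..n}"
      have "odd i"
      proof
        assume "even i"
        then obtain k where "i = k + k"
          by (metis evenE mult_2)
        then show False
          using i t by auto
      qed
      then show "g i = 0"
        by (simp add: g_def bser_square_nth)
    qed
  qed auto
  also have "\<dots> = (\<Sum>k\<in>{0..n}. g (k + k))"
    by (subst sum.reindex) (auto simp: inj_on_def)
  also have "\<dots> = (\<Sum>k\<in>{0..n}. fps_nth r k * cartier_poly e (fps_nth x (n - k + (n - k) + t)))"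
  proof (rule sum.cong[OF refl])
    fix k
    assume "k \<in> {0..n}"
    then have "n + n + t - (k + k) = n - k + (n - k) + t"
      by auto
    then show "g (k + k) = fps_nth r k * cartier_poly e (fps_nth x (n - k + (n - k) + t))"
      unfolding g_def by (simp add: bser_square_nth cartier_poly_square_mult[OF e])
  qed
  also have "\<dots> = fps_nth (r * cartier e t x) n"
    by (simp add: fps_mult_nth cartier_def)
  finally show "fps_nth (cartier e t (r * r * x)) n = fps_nth (r * cartier e t x) n" .
qed

section \<open>Variables and supports of series\<close>

definition Xv :: "nat \<Rightarrow> bser" where
  "Xv v = fps_const (Poly_Mapping.single (Poly_Mapping.single v 1) 1)"

definition supported_in :: "mono set \<Rightarrow> bser \<Rightarrow> bool" where
  "supported_in A F \<longleftrightarrow> (\<forall>n N. lk (fps_nth F n) N \<noteq> 0 \<longrightarrow> N \<in> A)"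

lemma supported_in_add:
  assumes "supported_in A F" "supported_in A G"
  shows "supported_in A (F + G)"
  using assms unfolding supported_in_def by (metis add_0 fps_add_nth lookup_add)

lemma supported_in_0 [simp]: "supported_in A 0"
  by (simp add: supported_in_def)

lemma supported_in_sum:
  assumes "\<And>i. i \<in> I \<Longrightarrow> supported_in A (F i)"
  shows "supported_in A (\<Sum>i\<in>I. F i)"
  using assms by (induction I rule: infinite_finite_induct) (auto simp: supported_in_add)

lemma supported_in_iff_keys:
  "supported_in A F \<longleftrightarrow> (\<forall>n. Poly_Mapping.keys (fps_nth F n) \<subseteq> A)"
  unfolding supported_in_def subset_iff in_keys_iff ..

lemma supported_in_mult:
  assumes "supported_in A F" "supported_in A G"
    and "\<And>M N. M \<in> A \<Longrightarrow> N \<in> A \<Longrightarrow> M + N \<in> A"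
  shows "supported_in A (F * G)"
  unfolding supported_in_iff_keys
proof
  fix n
  have "Poly_Mapping.keys (fps_nth (F * G) n) \<subseteq> (\<Union>i\<in>{0..n}. Poly_Mapping.keys (fps_nth F i * fps_nth G (n - i)))"
    unfolding fps_mult_nth
  proof
    fix N
    assume "N \<in> Poly_Mapping.keys (\<Sum>i = 0..n. fps_nth F i * fps_nth G (n - i))"
    then have "(\<Sum>i = 0..n. lk (fps_nth F i * fps_nth G (n - i)) N) \<noteq> 0"
      by (simp add: in_keys_iff lookup_sum)
    then obtain i where "i \<in> {0..n}" "lk (fps_nth F i * fps_nth G (n - i)) N \<noteq> 0"
      using sum.not_neutral_contains_not_neutral by blast
    then show "N \<in> (\<Union>i\<in>{0..n}. Poly_Mapping.keys (fps_nth F i * fps_nth G (n - i)))"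
      by (auto simp: in_keys_iff)
  qed
  also have "\<dots> \<subseteq> A"
  proof (rule UN_least)
    fix i
    have "Poly_Mapping.keys (fps_nth F i * fps_nth G (n - i))
      \<subseteq> {a + b | a b. a \<in> Poly_Mapping.keys (fps_nth F i) \<and> b \<in> Poly_Mapping.keys (fps_nth G (n - i))}"
      by (rule keys_mult)
    also have "\<dots> \<subseteq> A"
      using assms unfolding supported_in_iff_keys by blast
    finally show "Poly_Mapping.keys (fps_nth F i * fps_nth G (n - i)) \<subseteq> A" .
  qed
  finally show "Poly_Mapping.keys (fps_nth (F * G) n) \<subseteq> A" .
qed

lemma supported_in_1: "0 \<in> A \<Longrightarrow> supported_in A 1"
  by (auto simp: supported_in_def lookup_one when_def split: if_splits)

lemma supported_in_prod:
  assumes "\<And>i. i \<in> I \<Longrightarrow> supported_in A (F i)" "0 \<in> A"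
    and "\<And>M N. M \<in> A \<Longrightarrow> N \<in> A \<Longrightarrow> M + N \<in> A"
  shows "supported_in A (\<Prod>i\<in>I. F i)"
  using assms
  by (induction I rule: infinite_finite_induct) (auto intro!: supported_in_1 supported_in_mult)

lemma supported_in_fps_X: "0 \<in> A \<Longrightarrow> supported_in A fps_X"
  by (auto simp: supported_in_def fps_X_def lookup_one when_def split: if_splits)

lemma supported_in_Xv: "Poly_Mapping.single v 1 \<in> A \<Longrightarrow> supported_in A (Xv v)"
  by (auto simp: supported_in_def Xv_def lookup_single when_def split: if_splits)

lemma lookup_Xv_mult:
  "lk (fps_nth (Xv v * F) n) (Poly_Mapping.single v 1 + K) = lk (fps_nth F n) K"
  by (simp add: Xv_def lookup_single_mult(1))

lemma lookup_Xv_mult_eq_0: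
  assumes "lk L v = 0"
  shows "lk (fps_nth (Xv v * F) n) L = 0"
proof -
  have "L \<noteq> Poly_Mapping.single v 1 + K" for K
    using assms by (auto simp: lookup_add)
  then show ?thesis
    by (simp add: Xv_def lookup_single_mult(2))
qed

lemma cartier_Xv_mult: "cartier (Poly_Mapping.single v 1 + e) t (Xv v * F) = cartier e t F"
proof (rule fps_ext, rule poly_mapping_eqI)
  fix n M
  have "M + M + (Poly_Mapping.single v 1 + e) = Poly_Mapping.single v 1 + (M + M + e)"
    by (simp add: add_ac)
  then show "lk (fps_nth (cartier (Poly_Mapping.single v 1 + e) t (Xv v * F)) n) M = lk (fps_nth (cartier e t F) n) M"
    by (simp only: cartier_def fps_nth_Abs_fps lookup_cartier_poly lookup_Xv_mult)
qed

text \<open>The operator asks for a positive exponent of the variable \<open>v\<close>, which never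
  occurs in \<open>F\<close>.\<close>

lemma cartier_free_eq_0:
  assumes "supported_in {N. lk N v = 0} F"
  shows "cartier (Poly_Mapping.single v 1 + e) t F = 0"
proof (rule fps_ext, rule poly_mapping_eqI)
  fix n M
  have "lk (M + M + (Poly_Mapping.single v 1 + e)) v \<noteq> 0"
    by (simp add: lookup_add)
  then have "lk (fps_nth F (n + n + t)) (M + M + (Poly_Mapping.single v 1 + e)) = 0"
    using assms[unfolded supported_in_def mem_Collect_eq, rule_format, of "n + n + t" "M + M + (Poly_Mapping.single v 1 + e)"]
    by (rule contrapos_np)
  then show "lk (fps_nth (cartier (Poly_Mapping.single v 1 + e) t F) n) M = lk (fps_nth 0 n) M"
    by (simp only: cartier_def fps_nth_Abs_fps lookup_cartier_poly fps_zero_nth lookup_zero)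
qed

section \<open>Homogeneous components for a grading of the monomials\<close>

definition wpart :: "(mono \<Rightarrow> 'q) \<Rightarrow> 'q \<Rightarrow> bser \<Rightarrow> bser" where
  "wpart wt q F = Abs_fps (\<lambda>n. Poly_Mapping.mapp (\<lambda>N b. if wt N = q then b else 0) (fps_nth F n))"

lemma lookup_wpart: "lk (fps_nth (wpart wt q F) n) N = (if wt N = q then lk (fps_nth F n) N else 0)"
  by (simp add: wpart_def lookup_mapp when_def in_keys_iff)

lemma wpart_add: "wpart wt q (F + G) = wpart wt q F + wpart wt q G"
  by (rule fps_ext, rule poly_mapping_eqI) (simp add: lookup_wpart lookup_add)

lemma wpart_0 [simp]: "wpart wt q 0 = 0"
  by (rule fps_ext, rule poly_mapping_eqI) (simp add: lookup_wpart)

lemma wpart_sum: "wpart wt q (\<Sum>i\<in>I. F i) = (\<Sum>i\<in>I. wpart wt q (F i))"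
  by (induction I rule: infinite_finite_induct) (auto simp: wpart_add)

lemma wpart_fps_X_mult: "wpart wt q (fps_X * F) = fps_X * wpart wt q F"
  by (rule fps_ext, rule poly_mapping_eqI) (simp add: lookup_wpart)

lemma wpart_fps_X_power_mult: "wpart wt q (fps_X ^ k * F) = fps_X ^ k * wpart wt q F"
  by (induction k) (auto simp: wpart_fps_X_mult mult.assoc)

lemma wpart_Xv_mult:
  fixes x q :: "'q::ab_group_add"
  assumes "\<And>K. wt (Poly_Mapping.single v 1 + K) = x + wt K"
  shows "wpart wt q (Xv v * F) = Xv v * wpart wt (q - x) F"
proof (rule fps_ext, rule poly_mapping_eqI)
  fix n L
  show "lk (fps_nth (wpart wt q (Xv v * F)) n) L = lk (fps_nth (Xv v * wpart wt (q - x) F) n) L"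
  proof (cases "lk L v = 0")
    case True
    then show ?thesis
      by (simp only: lookup_wpart lookup_Xv_mult_eq_0 if_cancel)
  next
    case False
    have "L = Poly_Mapping.single v 1 + (L - Poly_Mapping.single v 1)"
      using False
      by (intro poly_mapping_eqI) (auto simp: lookup_add lookup_minus lookup_single when_def)
    then obtain K where L: "L = Poly_Mapping.single v 1 + K"
      by blast
    have "x + wt K = q \<longleftrightarrow> wt K = q - x"
      by (auto simp: algebra_simps)
    then show ?thesis
      by (simp only: L lookup_wpart lookup_Xv_mult assms)
  qed
qed

lemma cartier_wpart:
  assumes "\<And>M. wt (M + M + e) = q' \<longleftrightarrow> wt M = q"
  shows "cartier e t (wpart wt q' F) = wpart wt q (cartier e t F)"
  by (rule fps_ext, rule poly_mapping_eqI)
     (simp add: cartier_def lookup_cartier_poly lookup_wpart assms)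

lemma supported_in_wpart: "supported_in A F \<Longrightarrow> supported_in A (wpart wt q F)"
  unfolding supported_in_def lookup_wpart by presburger

text \<open>The inverse of \<open>1 - \<tau> P\<close>, with \<open>\<tau>\<close> being \<open>fps_X\<close>; signs do not matter in characteristic 2.\<close>

definition geo :: "bpoly \<Rightarrow> bser" where
  "geo P = Abs_fps (\<lambda>n. P ^ n)"

lemma geo_inverse: "(1 + fps_X * fps_const P) * geo P = 1"
proof (rule fps_ext)
  fix n
  show "fps_nth ((1 + fps_X * fps_const P) * geo P) n = fps_nth 1 n"
    by (cases n) (simp_all add: geo_def distrib_right mult.assoc bpoly_double del: mult_2 flip: mult_2)
qed

lemma supported_in_geo:
  assumes "supported_in A (fps_const P)" "0 \<in> A"
    and "\<And>M N. M \<in> A \<Longrightarrow> N \<in> A \<Longrightarrow> M + N \<in> A"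
  shows "supported_in A (geo P)"
proof -
  have "supported_in A (fps_const P ^ n)" for n
  proof (induction n)
    case (Suc n)
    then show ?case
      unfolding power_Suc by (intro supported_in_mult assms)
  qed (simp add: supported_in_1 assms)
  then have "supported_in A (fps_const (P ^ n))" for n
    by (simp add: fps_const_power)
  then show ?thesis
    unfolding supported_in_def geo_def fps_nth_Abs_fps by (metis fps_nth_fps_const)
qed

lemma sum_Xv_eq_const: "(\<Sum>s\<in>S. Xv (g s)) = fps_const (\<Sum>s\<in>S. Poly_Mapping.single (Poly_Mapping.single (g s) 1) 1)"
  unfolding Xv_def by (induction S rule: infinite_finite_induct) auto

text \<open>Distinct variables multiply to a squarefree monomial, which is the condition on
  \<open>e\<close> in \<open>cartier_square_mult\<close>.\<close>

lemma lookup_sum_single_le_1: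
  assumes "finite P" "inj_on g P"
  shows "lk (\<Sum>x\<in>P. Poly_Mapping.single (g x) 1) i \<le> (1::nat)"
proof -
  have "lk (\<Sum>x\<in>P. Poly_Mapping.single (g x) 1) i = (\<Sum>x\<in>P. if g x = i then 1 else 0 :: nat)"
    by (simp only: lookup_sum lookup_single when_def)
  also have "\<dots> = (\<Sum>j\<in>g ` P. if j = i then 1 else 0)"
    by (simp only: sum.reindex[OF assms(2)] o_def)
  also have "\<dots> \<le> 1"
    using assms by simp
  finally show ?thesis .
qed

lemma cartier_fps_X_square_mult:
  assumes "\<And>i. lk e i \<le> 1" "t \<le> 1"
  shows "cartier e t (fps_X ^ (j + j) * F) = fps_X ^ j * cartier e t F"
  by (simp add: power_add cartier_square_mult[OF assms])

lemma fps_nth_geo_0 [simp]: "fps_nth (geo P) 0 = 1"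
  by (simp add: geo_def)

section \<open>Monotonicity in the first half\<close>

locale finite_basis =
  fixes Y :: "'q::real_vector set"
  assumes finite_Y: "finite Y" and indep: "independent Y"
begin

abbreviation c :: "'q \<Rightarrow> 'q \<Rightarrow> real" where "c \<equiv> representation Y"

definition ht :: "'q \<Rightarrow> real" where "ht x = (\<Sum>y\<in>Y. c x y)"

lemma c_add: "x \<in> span Y \<Longrightarrow> x' \<in> span Y \<Longrightarrow> c (x + x') y = c x y + c x' y"
  using representation_add[OF indep] by simp

lemma c_diff: "x \<in> span Y \<Longrightarrow> x' \<in> span Y \<Longrightarrow> c (x - x') y = c x y - c x' y"
  using representation_diff[OF indep] by simp

lemma c_basis: "y \<in> Y \<Longrightarrow> c y y' = (if y' = y then 1 else 0)"
  using representation_basis[OF indep] by simp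

lemma c_sum: "(\<And>i. i \<in> I \<Longrightarrow> x i \<in> span Y) \<Longrightarrow> c (\<Sum>i\<in>I. x i) y = (\<Sum>i\<in>I. c (x i) y)"
  using representation_sum[OF indep, of I x] by simp

lemma c_scale: "x \<in> span Y \<Longrightarrow> c (r *\<^sub>R x) y = r * c x y"
  using representation_scale[OF indep] by simp

lemma span_Y: "y \<in> Y \<Longrightarrow> y \<in> span Y"
  by (rule span_base)

lemma ht_add: "x \<in> span Y \<Longrightarrow> x' \<in> span Y \<Longrightarrow> ht (x + x') = ht x + ht x'"
  by (simp add: ht_def c_add sum.distrib)

lemma ht_diff: "x \<in> span Y \<Longrightarrow> x' \<in> span Y \<Longrightarrow> ht (x - x') = ht x - ht x'"
  by (simp add: ht_def c_diff sum_subtractf)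

lemma ht_sum: "(\<And>i. i \<in> I \<Longrightarrow> x i \<in> span Y) \<Longrightarrow> ht (\<Sum>i\<in>I. x i) = (\<Sum>i\<in>I. ht (x i))"
  by (simp add: ht_def c_sum sum.swap[of _ I])

lemma ht_basis: "y \<in> Y \<Longrightarrow> ht y = 1"
  using finite_Y by (simp add: ht_def c_basis)

lemma sum_c: "x \<in> span Y \<Longrightarrow> (\<Sum>y\<in>Y. c x y *\<^sub>R y) = x"
  using sum_representation_eq[OF indep _ finite_Y order.refl] by simp

lemma eq_if_c_eq:
  assumes "x \<in> span Y" "x' \<in> span Y" "\<And>y. y \<in> Y \<Longrightarrow> c x y = c x' y"
  shows "x = x'"
proof -
  have "(\<Sum>y\<in>Y. c x y *\<^sub>R y) = (\<Sum>y\<in>Y. c x' y *\<^sub>R y)"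
    using assms(3) by (intro sum.cong) auto
  then show ?thesis
    by (simp only: sum_c[OF assms(1)] sum_c[OF assms(2)])
qed

lemma c_combination:
  assumes "y \<in> Y"
  shows "c (\<Sum>z\<in>Y. r z *\<^sub>R z) y = r y"
proof -
  have "c (\<Sum>z\<in>Y. r z *\<^sub>R z) y = (\<Sum>z\<in>Y. if z = y then r z else 0)"
    by (subst c_sum) (auto simp: span_scale span_Y c_scale c_basis intro!: sum.cong)
  then show ?thesis
    using assms finite_Y by simp
qed

end

text \<open>The assumption \<open>integral\<close> is the form in which primality of the volume will
  enter: a class modulo the lattice of the vertices is trivial or has no integral coordinate at
  all.\<close>

locale simplex_coordinates = finite_basis Y for Y :: "'q::real_vector set" +
  fixes L :: "'q set"
  assumes Y_subset: "Y \<subseteq> L" and L_span: "L \<subseteq> span Y"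
    and L_0: "0 \<in> L"
    and L_add: "x \<in> L \<Longrightarrow> x' \<in> L \<Longrightarrow> x + x' \<in> L"
    and L_diff: "x \<in> L \<Longrightarrow> x' \<in> L \<Longrightarrow> x - x' \<in> L"
    and finite_open_box: "finite {x \<in> L. \<forall>y\<in>Y. 0 < c x y \<and> c x y < 1}"
    and integral: "x \<in> L \<Longrightarrow> y \<in> Y \<Longrightarrow> y' \<in> Y \<Longrightarrow> c x y \<in> \<int> \<Longrightarrow> c x y' \<in> \<int>"
begin

lemma span_L: "x \<in> L \<Longrightarrow> x \<in> span Y"
  using L_span by blast

text \<open>The box is open, so zero is excluded: if \<open>Y\<close> is nonempty then
  \<open>A 0\<close> is empty, and the entry of the h*-vector in degree 0 has to be handled
  apart.\<close>

definition A :: "nat \<Rightarrow> 'q set" where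
  "A k = {x \<in> L. (\<forall>y\<in>Y. 0 < c x y \<and> c x y < 1) \<and> ht x = real k}"

lemma finite_A: "finite (A k)"
  by (rule finite_subset[OF _ finite_open_box]) (auto simp: A_def)

lemma L_sum: "(\<And>i. i \<in> I \<Longrightarrow> x i \<in> L) \<Longrightarrow> (\<Sum>i\<in>I. x i) \<in> L"
  by (induction I rule: infinite_finite_induct) (auto intro: L_add L_0)

definition one :: 'q where "one = (\<Sum>y\<in>Y. y)"

lemma c_one: "y \<in> Y \<Longrightarrow> c one y = 1"
  unfolding one_def using finite_Y by (subst c_sum) (auto simp: c_basis span_Y)

lemma one_span: "one \<in> span Y"
  unfolding one_def by (rule span_sum) (rule span_Y)

lemma ht_one: "ht one = real (card Y)"
  by (simp add: ht_def c_one)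

lemma A_D: "x \<in> A k \<Longrightarrow> x \<in> L" "x \<in> A k \<Longrightarrow> x \<in> span Y" "x \<in> A k \<Longrightarrow> y \<in> Y \<Longrightarrow> 0 < c x y"
  "x \<in> A k \<Longrightarrow> y \<in> Y \<Longrightarrow> c x y < 1" "x \<in> A k \<Longrightarrow> ht x = real k"
  by (auto simp: A_def span_L)

lemma one_L: "one \<in> L"
  unfolding one_def using Y_subset by (intro L_sum) auto

lemma A_complement:
  assumes "x \<in> A k" "k \<le> card Y"
  shows "one - x \<in> A (card Y - k)"
  using assms A_D[OF assms(1)] one_L
  by (auto simp: A_def c_diff one_span c_one ht_diff ht_one of_nat_diff intro: L_diff)

lemma card_A_complement_le:
  assumes "k \<le> card Y"
  shows "card (A k) \<le> card (A (card Y - k))"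
  by (rule card_inj_on_le[where f = "\<lambda>x. one - x"]) (auto simp: inj_on_def finite_A assms intro: A_complement[OF _ assms])

lemma card_A_complement:
  assumes "k \<le> card Y"
  shows "card (A (card Y - k)) = card (A k)"
  using card_A_complement_le[of k] card_A_complement_le[of "card Y - k"] assms by auto

end

text \<open>The consequence of the integer decomposition property that is used: the summands are
  points of height 1 other than vertices.\<close>

locale idp_simplex = simplex_coordinates Y L for Y L :: "'q::real_vector set" +
  assumes idp: "1 \<le> k \<Longrightarrow> x \<in> A k \<Longrightarrow> \<exists>w::nat \<Rightarrow> 'q. (\<forall>i<k. w i \<in> A 1) \<and> x = (\<Sum>i<k. w i)"

locale idp_simplex_vars = idp_simplex Y L for Y L :: "'q::real_vector set" +
  fixes enc :: "'q \<times> 'q \<Rightarrow> nat"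
  assumes inj_enc: "inj_on enc (insert 0 Y \<times> A 1)"
begin

abbreviation S where "S \<equiv> A 1"

lemma zero_notin_Y: "0 \<notin> Y"
  using indep dependent_zero by blast

lemma enc_eq_iff: "y \<in> insert 0 Y \<Longrightarrow> y' \<in> insert 0 Y \<Longrightarrow> s \<in> S \<Longrightarrow> s' \<in> S
    \<Longrightarrow> enc (y, s) = enc (y', s') \<longleftrightarrow> y = y' \<and> s = s'"
  using inj_on_eq_iff[OF inj_enc, of "(y, s)" "(y', s')"] by simp

text \<open>The variable \<open>(y, s)\<close> with \<open>y \<in> Y\<close> is the coefficient of \<open>s\<close> in the parameter at the vertex \<open>y\<close>; since
  \<open>0 \<notin> Y\<close>, the variables \<open>(0, s)\<close> are free to serve as the coefficients of the generic linear form.\<close>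

definition wt :: "mono \<Rightarrow> 'q" where
  "wt N = (\<Sum>y\<in>Y. \<Sum>s\<in>S. real (lk N (enc (y, s))) *\<^sub>R (s - y))"

lemma wt_0 [simp]: "wt 0 = 0"
  by (simp add: wt_def)

lemma wt_add: "wt (M + N) = wt M + wt N"
  by (simp add: wt_def lookup_add scaleR_add_left sum.distrib)

lemma wt_single:
  assumes "y \<in> insert 0 Y" "s \<in> S"
  shows "wt (Poly_Mapping.single (enc (y, s)) 1) = (if y = 0 then 0 else s - y)"
proof -
  have "wt (Poly_Mapping.single (enc (y, s)) 1)
      = (\<Sum>y'\<in>Y. \<Sum>s'\<in>S. if y' = y \<and> s' = s then s - y else 0)"
    unfolding wt_def lookup_single when_def
    using assms by (intro sum.cong refl) (auto simp: enc_eq_iff)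
  also have "\<dots> = (\<Sum>y'\<in>Y. if y' = y then s - y else 0)"
    using assms finite_A[of 1] by (intro sum.cong refl) auto
  also have "\<dots> = (if y = 0 then 0 else s - y)"
    using assms finite_Y zero_notin_Y by auto
  finally show ?thesis .
qed

lemma S_span: "s \<in> S \<Longrightarrow> s \<in> span Y"
  by (rule A_D)

lemma c_wt: "c (wt N) y = (\<Sum>y'\<in>Y. \<Sum>s\<in>S. real (lk N (enc (y', s))) * (c s y - c y' y))"
proof -
  have sp: "real (lk N (enc (y', s))) *\<^sub>R (s - y') \<in> span Y" if "y' \<in> Y" "s \<in> S" for y' s
    using that by (intro span_scale span_diff S_span span_Y)
  have "c (wt N) y = (\<Sum>y'\<in>Y. c (\<Sum>s\<in>S. real (lk N (enc (y', s))) *\<^sub>R (s - y')) y)"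
    unfolding wt_def by (rule c_sum) (intro span_sum sp)
  also have "\<dots> = (\<Sum>y'\<in>Y. \<Sum>s\<in>S. c (real (lk N (enc (y', s))) *\<^sub>R (s - y')) y)"
    by (rule sum.cong[OF refl], rule c_sum) (rule sp)
  also have "\<dots> = (\<Sum>y'\<in>Y. \<Sum>s\<in>S. real (lk N (enc (y', s))) * (c s y - c y' y))"
    by (rule sum.cong[OF refl], rule sum.cong[OF refl]) (simp add: c_scale c_diff span_diff S_span span_Y)
  finally show ?thesis .
qed

definition P :: "'q \<Rightarrow> bpoly" where
  "P y = (\<Sum>s\<in>S. Poly_Mapping.single (Poly_Mapping.single (enc (y, s)) 1) 1)"

text \<open>The parameter at \<open>y\<close> divided by the monomial of \<open>y\<close>. The
  lattice monomials x^(s-y) are not written, since \<open>wt\<close> recovers them from the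
  variables.\<close>

definition U :: "'q \<Rightarrow> bser" where "U y = 1 + fps_X * fps_const (P y)"

lemma const_P: "fps_const (P y) = (\<Sum>s\<in>S. Xv (enc (y, s)))"
  by (simp add: P_def sum_Xv_eq_const)

definition \<Omega> :: bser where "\<Omega> = (\<Prod>y\<in>Y. geo (P y))"

text \<open>The coefficient of x^q in \<Omega>. As a degree map it is read with complements: the
  value on x^u is \<open>W (one - u)\<close>.\<close>

definition W :: "'q \<Rightarrow> bser" where "W q = wpart wt q \<Omega>"

lemma U_geo: "U y * geo (P y) = 1"
  by (simp add: U_def geo_inverse)

lemma supported_in_const_P:
  assumes "\<And>s. s \<in> S \<Longrightarrow> Poly_Mapping.single (enc (y, s)) 1 \<in> B"
  shows "supported_in B (fps_const (P y))"
  unfolding const_P by (intro supported_in_sum supported_in_Xv assms)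

lemma supported_in_U:
  assumes "\<And>s. s \<in> S \<Longrightarrow> Poly_Mapping.single (enc (y, s)) 1 \<in> B" "0 \<in> B"
    and "\<And>M N. M \<in> B \<Longrightarrow> N \<in> B \<Longrightarrow> M + N \<in> B"
  shows "supported_in B (U y)"
  unfolding U_def
  by (intro supported_in_add supported_in_1 supported_in_mult supported_in_fps_X supported_in_const_P assms)

lemma supported_in_geo_P:
  assumes "\<And>s. s \<in> S \<Longrightarrow> Poly_Mapping.single (enc (y, s)) 1 \<in> B" "0 \<in> B"
    and "\<And>M N. M \<in> B \<Longrightarrow> N \<in> B \<Longrightarrow> M + N \<in> B"
  shows "supported_in B (geo (P y))"
  by (intro supported_in_geo supported_in_const_P assms)

text \<open>At \<tau> = 0 only the constant term of \<Omega> survives, so the matrix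
  \<open>W (g - z)\<close> is the identity modulo \<tau>; \<open>kernel_trivial\<close> relies on
  this.\<close>

lemma fps_nth_W_0: "fps_nth (W q) 0 = (if q = 0 then 1 else 0)"
proof -
  have "fps_nth (\<Prod>y\<in>Z. geo (P y)) 0 = 1" for Z
    by (induction Z rule: infinite_finite_induct) auto
  from this[of Y] have "fps_nth \<Omega> 0 = 1"
    by (simp only: \<Omega>_def)
  then show ?thesis
    by (intro poly_mapping_eqI) (auto simp: lookup_wpart W_def lookup_one when_def)
qed

text \<open>The parameter at \<open>y\<close> acts as zero: multiplication by \<open>U y\<close>
  removes the factor of \<Omega> at \<open>y\<close>, and monomials without the variables
  \<open>(y, s)\<close> only have weights with nonnegative coordinate at \<open>y\<close>.\<close>

lemma W_recurrence:
  assumes y: "y \<in> Y" and neg: "c q y < 0"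
  shows "W q = (\<Sum>s\<in>S. fps_X * Xv (enc (y, s)) * W (q - s + y))"
proof -
  define \<Omega>' where "\<Omega>' = (\<Prod>y'\<in>Y - {y}. geo (P y'))"
  have \<Omega>: "\<Omega> = geo (P y) * \<Omega>'"
    unfolding \<Omega>_def \<Omega>'_def using y finite_Y by (simp add: prod.remove)
  have "U y * \<Omega> = \<Omega>'"
    unfolding \<Omega> mult.assoc[symmetric] U_geo by simp
  then have "\<Omega> + fps_X * fps_const (P y) * \<Omega> = \<Omega>'"
    by (simp add: U_def distrib_right)
  moreover have "\<Omega> = (\<Omega> + fps_X * fps_const (P y) * \<Omega>) + fps_X * fps_const (P y) * \<Omega>"
    by (simp only: add.assoc bser_double add_0_right)
  ultimately have "\<Omega> = \<Omega>' + fps_X * fps_const (P y) * \<Omega>"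
    by simp
  then have \<Omega>_eq: "\<Omega> = \<Omega>' + (\<Sum>s\<in>S. fps_X * (Xv (enc (y, s)) * \<Omega>))"
    by (simp add: const_P sum_distrib_left sum_distrib_right mult.assoc)
  have "W q = wpart wt q (\<Omega>' + (\<Sum>s\<in>S. fps_X * (Xv (enc (y, s)) * \<Omega>)))"
    unfolding W_def using \<Omega>_eq by (rule arg_cong)
  also have "\<dots> = wpart wt q \<Omega>' + (\<Sum>s\<in>S. fps_X * wpart wt q (Xv (enc (y, s)) * \<Omega>))"
    by (simp only: wpart_add wpart_sum wpart_fps_X_mult)
  also have "(\<Sum>s\<in>S. fps_X * wpart wt q (Xv (enc (y, s)) * \<Omega>)) = (\<Sum>s\<in>S. fps_X * (Xv (enc (y, s)) * W (q - s + y)))"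
  proof (intro sum.cong refl arg_cong[where f = "\<lambda>x. fps_X * x"])
    fix s
    assume s: "s \<in> S"
    have "wt (Poly_Mapping.single (enc (y, s)) 1) = s - y"
      using wt_single[of y s] y s zero_notin_Y by auto
    then have "wpart wt q (Xv (enc (y, s)) * \<Omega>) = Xv (enc (y, s)) * wpart wt (q - (s - y)) \<Omega>"
      by (intro wpart_Xv_mult) (simp only: wt_add)
    then show "wpart wt q (Xv (enc (y, s)) * \<Omega>) = Xv (enc (y, s)) * W (q - s + y)"
      by (simp add: W_def algebra_simps)
  qed
  also have "wpart wt q \<Omega>' = 0"
  proof (rule fps_ext, rule poly_mapping_eqI)
    fix n N
    have free: "supported_in {N. \<forall>s\<in>S. lk N (enc (y, s)) = 0} \<Omega>'"
      unfolding \<Omega>'_def using y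
      by (intro supported_in_prod supported_in_geo_P) (auto simp: lookup_add lookup_single when_def enc_eq_iff)
    have "c (wt N) y \<ge> 0" if "\<forall>s\<in>S. lk N (enc (y, s)) = 0"
      unfolding c_wt
    proof (intro sum_nonneg)
      fix y' s
      assume *: "y' \<in> Y" "s \<in> S"
      show "0 \<le> real (lk N (enc (y', s))) * (c s y - c y' y)"
      proof (cases "y' = y")
        case False
        then have "c y' y = 0" "0 < c s y"
          using * y A_D(3) by (auto simp: c_basis)
        then show ?thesis
          by simp
      qed (use * that in simp)
    qed
    then have no: "wt N \<noteq> q" if "\<forall>s\<in>S. lk N (enc (y, s)) = 0"
      using that neg by auto
    have "lk (fps_nth \<Omega>' n) N = 0" if "wt N = q"
    proof (rule ccontr)
      assume "lk (fps_nth \<Omega>' n) N \<noteq> 0"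
      then have "N \<in> {N. \<forall>s\<in>S. lk N (enc (y, s)) = 0}"
        using free unfolding supported_in_def by (elim allE impE)
      then show False
        using no that by simp
    qed
    then show "lk (fps_nth (wpart wt q \<Omega>') n) N = lk (fps_nth 0 n) N"
      by (simp add: lookup_wpart)
  qed
  finally show ?thesis
    by (simp add: mult.assoc)
qed

text \<open>Each \<open>U y\<close> is 1 plus \<tau> times a linear form in its own variables, so
  demanding an odd exponent of \<open>(y, u y)\<close> selects a single term and leaves one \<tau>
  per vertex.\<close>

lemma cartier_prod_U:
  assumes u: "\<And>y. y \<in> Y \<Longrightarrow> u y \<in> S" and "Z \<subseteq> Y"
  shows "cartier (\<Sum>y\<in>Z. Poly_Mapping.single (enc (y, u y)) 1) t (fps_X ^ k * (\<Prod>y\<in>Z. U y)) = cartier 0 t (fps_X ^ (k + card Z))"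
  using finite_subset[OF assms(2) finite_Y] assms(2)
proof (induction Z arbitrary: k rule: finite_induct)
  case (insert y Z)
  let ?e = "\<Sum>y\<in>Z. Poly_Mapping.single (enc (y, u y)) 1" and ?v = "enc (y, u y)"
  let ?F = "fps_X ^ k * (\<Prod>y\<in>Z. U y)"
  have uy: "u y \<in> S"
    using insert u by auto
  have X: "supported_in {N. lk N ?v = 0} (fps_X ^ k)" for k
    by (induction k) (auto intro!: supported_in_1 supported_in_mult supported_in_fps_X simp: lookup_add)
  have free: "supported_in {N. lk N ?v = 0} (fps_X ^ k * (\<Prod>y\<in>Z. U y))" for k
    using insert uy
    by (intro supported_in_mult supported_in_prod supported_in_U X) (auto simp: lookup_add lookup_single when_def enc_eq_iff)
  have "fps_X ^ k * (\<Prod>y\<in>insert y Z. U y) = ?F + (\<Sum>s\<in>S. Xv (enc (y, s)) * (fps_X ^ Suc k * (\<Prod>y\<in>Z. U y)))"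
    using insert by (simp add: U_def const_P sum_distrib_left sum_distrib_right algebra_simps)
  then have "cartier (\<Sum>y\<in>insert y Z. Poly_Mapping.single (enc (y, u y)) 1) t (fps_X ^ k * (\<Prod>y\<in>insert y Z. U y))
     = cartier (Poly_Mapping.single ?v 1 + ?e) t ?F
       + (\<Sum>s\<in>S. cartier (Poly_Mapping.single ?v 1 + ?e) t (Xv (enc (y, s)) * (fps_X ^ Suc k * (\<Prod>y\<in>Z. U y))))"
    by (simp only: cartier_add cartier_sum sum.insert[OF insert.hyps(1,2)])
  also have "cartier (Poly_Mapping.single ?v 1 + ?e) t ?F = 0"
    by (rule cartier_free_eq_0) (rule free)
  also have "(\<Sum>s\<in>S. cartier (Poly_Mapping.single ?v 1 + ?e) t (Xv (enc (y, s)) * (fps_X ^ Suc k * (\<Prod>y\<in>Z. U y))))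
      = (\<Sum>s\<in>S. if s = u y then cartier ?e t (fps_X ^ Suc k * (\<Prod>y\<in>Z. U y)) else 0)"
  proof (rule sum.cong[OF refl])
    fix s
    assume s: "s \<in> S"
    show "cartier (Poly_Mapping.single ?v 1 + ?e) t (Xv (enc (y, s)) * (fps_X ^ Suc k * (\<Prod>y\<in>Z. U y)))
      = (if s = u y then cartier ?e t (fps_X ^ Suc k * (\<Prod>y\<in>Z. U y)) else 0)"
    proof (cases "s = u y")
      case True
      then show ?thesis
        by (simp only: cartier_Xv_mult if_True simp_thms)
    next
      case False
      have "supported_in {N. lk N ?v = 0} (Xv (enc (y, s)) * (fps_X ^ Suc k * (\<Prod>y\<in>Z. U y)))"
        using s uy insert False
        by (intro supported_in_mult[OF supported_in_Xv free]) (auto simp: lookup_add lookup_single when_def enc_eq_iff)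
      then show ?thesis
        using False by (simp only: cartier_free_eq_0 if_False)
    qed
  qed
  also have "\<dots> = cartier ?e t (fps_X ^ Suc k * (\<Prod>y\<in>Z. U y))"
    using uy finite_A[of 1] by simp
  also have "\<dots> = cartier 0 t (fps_X ^ (Suc k + card Z))"
    using insert by blast
  finally show ?case
    using insert by simp
qed simp

lemma cartier_0_fps_X: "t \<le> 1 \<Longrightarrow> cartier 0 t (fps_X ^ (j + j + t)) = fps_X ^ j"
proof -
  assume t: "t \<le> 1"
  have "cartier 0 t (fps_X ^ (j + j) * fps_X ^ t) = fps_X ^ j * cartier 0 t (fps_X ^ t)"
    using t by (intro cartier_fps_X_square_mult) auto
  also have "cartier 0 t (fps_X ^ t) = 1"
  proof (intro fps_ext poly_mapping_eqI)
    fix n M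
    have "M + M = 0 \<longleftrightarrow> M = (0 :: mono)"
      using mono_halve_unique[of M 0] by auto
    then show "lk (fps_nth (cartier 0 t (fps_X ^ t)) n) M = lk (fps_nth 1 n) M"
      by (auto simp: cartier_def lookup_cartier_poly fps_X_power_nth lookup_one when_def)
  qed
  finally show ?thesis
    by (simp add: power_add)
qed

text \<open>Since \<Omega> inverts the product of all \<open>U y\<close>, it is its own square times
  this product; the splitting takes the root of the square. Choosing \<open>t\<close> as the parity
  of \<open>card Y\<close> keeps the power of \<tau> that comes from the product.\<close>

lemma cartier_\<Omega>:
  assumes u: "\<And>y. y \<in> Y \<Longrightarrow> u y \<in> S" and t: "card Y = j + j + t" "t \<le> 1"
  shows "cartier (\<Sum>y\<in>Y. Poly_Mapping.single (enc (y, u y)) 1) t \<Omega> = fps_X ^ j * \<Omega>"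
proof -
  have "inj_on (\<lambda>y. enc (y, u y)) Y"
    by (rule inj_onI) (metis enc_eq_iff u insertI2)
  note le1 = lookup_sum_single_le_1[OF finite_Y this]
  have "\<Omega> * (\<Prod>y\<in>Y. U y) = 1"
    unfolding \<Omega>_def prod.distrib[symmetric] using U_geo by (simp add: mult.commute)
  then have "\<Omega> = \<Omega> * \<Omega> * (\<Prod>y\<in>Y. U y)"
    by (simp add: mult.assoc)
  then have "cartier (\<Sum>y\<in>Y. Poly_Mapping.single (enc (y, u y)) 1) t \<Omega>
      = cartier (\<Sum>y\<in>Y. Poly_Mapping.single (enc (y, u y)) 1) t (\<Omega> * \<Omega> * (\<Prod>y\<in>Y. U y))"
    by (rule arg_cong)
  also have "\<dots> = \<Omega> * cartier (\<Sum>y\<in>Y. Poly_Mapping.single (enc (y, u y)) 1) t (\<Prod>y\<in>Y. U y)"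
    by (rule cartier_square_mult[OF le1 t(2)])
  also have "cartier (\<Sum>y\<in>Y. Poly_Mapping.single (enc (y, u y)) 1) t (\<Prod>y\<in>Y. U y) = fps_X ^ j"
    using cartier_prod_U[OF u order.refl, where t = t and k = 0] cartier_0_fps_X[OF t(2), of j] t(1) by simp
  finally show ?thesis
    by (simp add: mult.commute)
qed

lemma wt_sum_single:
  assumes u: "\<And>y. y \<in> Y \<Longrightarrow> u y \<in> S" and "Z \<subseteq> Y"
  shows "wt (\<Sum>y\<in>Z. Poly_Mapping.single (enc (y, u y)) 1) = (\<Sum>y\<in>Z. u y - y)"
  using finite_subset[OF assms(2) finite_Y] assms(2)
proof (induction Z rule: finite_induct)
  case (insert y Z)
  then have "y \<noteq> 0" "y \<in> insert 0 Y"
    using zero_notin_Y by auto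
  then show ?case
    using insert wt_single[of y "u y"] u[of y] by (simp only: sum.insert[OF insert.hyps(1,2)] wt_add if_False insert_subset simp_thms)
qed simp

text \<open>The eigenvector property component by component: taking roots halves the weight that
  remains after subtracting the weight of the selected monomial.\<close>

lemma cartier_W:
  assumes u: "\<And>y. y \<in> Y \<Longrightarrow> u y \<in> S" and t: "card Y = j + j + t" "t \<le> 1"
    and q': "q' = q + q + (\<Sum>y\<in>Y. u y - y)"
  shows "cartier (\<Sum>y\<in>Y. Poly_Mapping.single (enc (y, u y)) 1) t (W q') = fps_X ^ j * W q"
proof -
  have "wt (M + M + (\<Sum>y\<in>Y. Poly_Mapping.single (enc (y, u y)) 1)) = q' \<longleftrightarrow> wt M = q" for M
    using scaleR_cancel_left[of 2 "wt M" q]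
    by (simp only: wt_add wt_sum_single[OF u order.refl] q') (simp add: scaleR_2)
  then show ?thesis
    unfolding W_def by (simp only: cartier_wpart cartier_\<Omega>[OF u t] wpart_fps_X_power_mult)
qed

end

section \<open>The generic linear form and its kernel\<close>

context idp_simplex_vars
begin

lemma supported_in_\<Omega>:
  assumes s: "s \<in> S"
  shows "supported_in {N. lk N (enc (0, s)) = 0} \<Omega>"
proof -
  have "Poly_Mapping.single (enc (y, s')) (1::nat) \<in> {N. lk N (enc (0, s)) = 0}" if "y \<in> Y" "s' \<in> S" for y s'
    using enc_eq_iff[of y 0 s' s] that s zero_notin_Y by (auto simp: lookup_single when_def)
  then show ?thesis
    unfolding \<Omega>_def
    by (intro supported_in_prod supported_in_geo_P) (simp_all add: lookup_add)
qed

text \<open>The series \<Omega> has none of the variables \<open>(0, s)\<close>, so the term with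
  \<open>s0\<close> can be isolated from the linear form.\<close>

lemma cartier_var_mult_W:
  assumes "s0 \<in> S" "s \<in> S"
  shows "cartier (Poly_Mapping.single (enc (0, s0)) 1 + e) t (Xv (enc (0, s)) * W q)
    = (if s = s0 then cartier e t (W q) else 0)"
proof (cases "s = s0")
  case True
  then show ?thesis
    by (simp only: cartier_Xv_mult if_True simp_thms)
next
  case False
  then have "Poly_Mapping.single (enc (0, s)) (1::nat) \<in> {N. lk N (enc (0, s0)) = 0}"
    using enc_eq_iff[of 0 0 s s0] assms by (auto simp: lookup_single when_def)
  then have "supported_in {N. lk N (enc (0, s0)) = 0} (Xv (enc (0, s)) * W q)"
    unfolding W_def using assms
    by (intro supported_in_mult supported_in_Xv supported_in_wpart supported_in_\<Omega>) (auto simp: lookup_add)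
  then show ?thesis
    using False by (simp only: cartier_free_eq_0 if_False)
qed

text \<open>The series \<open>f z\<close> are the coefficients of an element of degree
  \<open>k\<close> annihilated by the generic linear form, expressed by pairing the product with the
  complements of all points of \<open>A (k + 1)\<close>. The aim is that \<open>f\<close>
  vanishes.\<close>

context
  fixes k :: nat and f :: "'q \<Rightarrow> bser"
  assumes k: "2 * (k + 1) \<le> card Y"
    and kernel: "g \<in> A (k + 1) \<Longrightarrow> (\<Sum>z\<in>A k. \<Sum>s\<in>S. f z * (Xv (enc (0, s)) * W (g - z - s))) = 0"
begin

text \<open>The degree map on the product of \<open>f\<close>, the generic linear form and a monomial: \<open>T q\<close> vanishes at the
  points of \<open>A (k + 1)\<close>, and \<open>W_recurrence\<close> propagates this \<open>\<tau>\<close>-adically to all \<open>q\<close> with coordinates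
  at most one.\<close>

definition T :: "'q \<Rightarrow> bser" where
  "T q = (\<Sum>z\<in>A k. \<Sum>s\<in>S. f z * (Xv (enc (0, s)) * W (q - z - s)))"

lemma T_recurrence:
  assumes q: "q \<in> L" and y: "y \<in> Y" and le: "c q y \<le> 0"
  shows "T q = (\<Sum>s'\<in>S. fps_X * (Xv (enc (y, s')) * T (q - s' + y)))"
proof -
  have W: "W (q - z - s) = (\<Sum>s'\<in>S. fps_X * Xv (enc (y, s')) * W (q - s' + y - z - s))"
    if "z \<in> A k" "s \<in> S" for z s
  proof -
    have "c (q - z - s) y = c q y - c z y - c s y"
      using that q A_D(2) by (simp add: c_diff span_diff span_L)
    \<comment> \<open>\<open>z\<close> and \<open>s\<close> have positive coordinates, which is why
      \<open>c q y = 0\<close> is allowed although \<open>W_recurrence\<close> needs a negative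
      coordinate.\<close>
    then have "c (q - z - s) y < 0"
      using that A_D(3)[of z k y] A_D(3)[of s 1 y] y le by simp
    from W_recurrence[OF y this] show ?thesis
      by (simp add: algebra_simps)
  qed
  have "T q = (\<Sum>z\<in>A k. \<Sum>s\<in>S. \<Sum>s'\<in>S. fps_X * (Xv (enc (y, s')) * (f z * (Xv (enc (0, s)) * W (q - s' + y - z - s)))))"
    unfolding T_def
  proof (rule sum.cong[OF refl], rule sum.cong[OF refl])
    fix z s
    assume "z \<in> A k" "s \<in> S"
    then show "f z * (Xv (enc (0, s)) * W (q - z - s))
        = (\<Sum>s'\<in>S. fps_X * (Xv (enc (y, s')) * (f z * (Xv (enc (0, s)) * W (q - s' + y - z - s)))))"
      by (subst W) (simp_all only: sum_distrib_left mult_ac)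
  qed
  also have "\<dots> = (\<Sum>z\<in>A k. \<Sum>s'\<in>S. \<Sum>s\<in>S. fps_X * (Xv (enc (y, s')) * (f z * (Xv (enc (0, s)) * W (q - s' + y - z - s)))))"
    by (rule sum.cong[OF refl]) (rule sum.swap)
  also have "\<dots> = (\<Sum>s'\<in>S. \<Sum>z\<in>A k. \<Sum>s\<in>S. fps_X * (Xv (enc (y, s')) * (f z * (Xv (enc (0, s)) * W (q - s' + y - z - s)))))"
    by (rule sum.swap)
  finally show ?thesis
    unfolding T_def by (simp add: sum_distrib_left)
qed

lemma fps_nth_T_eq_0:
  "q \<in> L \<Longrightarrow> (\<And>y. y \<in> Y \<Longrightarrow> c q y \<le> 1) \<Longrightarrow> ht q = real (k + 1) \<Longrightarrow> i < n \<Longrightarrow> fps_nth (T q) i = 0"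
proof (induction n arbitrary: q i)
  case (Suc n)
  show ?case
  proof (cases "\<exists>y\<in>Y. c q y \<le> 0")
    case True
    then obtain y where y: "y \<in> Y" "c q y \<le> 0"
      by blast
    have *: "fps_nth (fps_X * (Xv (enc (y, s)) * T (q - s + y))) i = 0" if s: "s \<in> S" for s
    proof (cases i)
      case (Suc i')
      have sp: "s \<in> span Y" "q \<in> span Y" "y \<in> span Y" "s \<in> L"
        using A_D[OF s] Suc.prems(1) span_L span_Y y by auto
      have "q - s + y \<in> L"
        using Suc.prems(1) sp(4) y Y_subset by (intro L_add L_diff) auto
      moreover have "c (q - s + y) y' \<le> 1" if y': "y' \<in> Y" for y'
      proof -
        \<comment> \<open>Only the coordinate at \<open>y\<close> can rise, from at most zero to
          less than one; the new point is again admissible, and the factor \<tau> lowers the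
          index.\<close>
        have "c (q - s + y) y' = c q y' - c s y' + (if y' = y then 1 else 0)"
          using sp y by (simp add: c_add c_diff span_diff c_basis)
        then show ?thesis
          using y Suc.prems(2)[OF y'] A_D(3)[OF s y'] by auto
      qed
      moreover have "ht (q - s + y) = real (k + 1)"
        using sp y A_D(5)[OF s] Suc.prems(3) by (simp add: ht_add ht_diff span_diff ht_basis)
      ultimately have "fps_nth (T (q - s + y)) i' = 0"
        using Suc.IH Suc.prems(4) \<open>i = Suc i'\<close> by auto
      then show ?thesis
        using \<open>i = Suc i'\<close> by (simp add: Xv_def)
    qed simp
    show ?thesis
      unfolding T_recurrence[OF Suc.prems(1) y] fps_sum_nth by (intro sum.neutral ballI *)
  next
    case False
    \<comment> \<open>All coordinates are in (0, 1] here. If one were 1, all would be integral and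
      hence 1, giving height \<open>card Y\<close>, which exceeds \<open>k + 1\<close>.\<close>
    have "c q y < 1" if y: "y \<in> Y" for y
    proof (rule ccontr)
      assume "\<not> c q y < 1"
      then have "c q y = 1"
        using Suc.prems(2)[OF y] by simp
      then have "c q y' \<in> \<int>" if "y' \<in> Y" for y'
        using integral[OF Suc.prems(1) y that] by simp
      then have "c q y' = 1" if "y' \<in> Y" for y'
        using that False Suc.prems(2)[OF that] by (force elim!: Ints_cases)
      then have "ht q = real (card Y)"
        by (simp add: ht_def)
      then show False
        using Suc.prems(3) k by simp
    qed
    then have "q \<in> A (k + 1)"
      using False Suc.prems by (auto simp: A_def not_le)
    then have "T q = 0"
      unfolding T_def by (rule kernel)
    then show ?thesis
      by simp
  qed
qed simp

lemma T_eq_0: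
  "q \<in> L \<Longrightarrow> (\<And>y. y \<in> Y \<Longrightarrow> c q y \<le> 1) \<Longrightarrow> ht q = real (k + 1) \<Longrightarrow> T q = 0"
  by (rule fps_ext) (simp add: fps_nth_T_eq_0[OF _ _ _ lessI])

text \<open>Multiplying the annihilated product once more by \<open>f\<close> gives a symmetric
  double sum, which in characteristic 2 leaves only the squares. The number of factors
  \<open>v i\<close> brings the total height, with \<open>2 * k + 1\<close> from the squares and the
  linear form, to \<open>card Y\<close>.\<close>

lemma sum_squares_eq_0:
  assumes "finite I" "card I = card Y - 2 * k - 1" and v: "\<And>i. i \<in> I \<Longrightarrow> v i \<in> S"
  shows "(\<Sum>z\<in>A k. \<Sum>s\<in>S. f z * f z * (Xv (enc (0, s)) * W (one - (\<Sum>i\<in>I. v i) - z - z - s))) = 0"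
proof -
  let ?v = "\<Sum>i\<in>I. v i"
  have vsp: "v i \<in> span Y" if "i \<in> I" for i
    using v[OF that] by (rule A_D)
  then have vs: "?v \<in> span Y"
    by (rule span_sum)
  have T0: "T (one - ?v - z) = 0" if z: "z \<in> A k" for z
  proof (rule T_eq_0)
    show "one - ?v - z \<in> L"
      using z v A_D(1) by (intro L_diff one_L L_sum) auto
    have cv: "c ?v y \<ge> 0" if "y \<in> Y" for y
    proof -
      have "c ?v y = (\<Sum>i\<in>I. c (v i) y)"
        by (rule c_sum) (rule vsp)
      then show ?thesis
        using A_D(3)[OF v that] by (simp add: sum_nonneg less_imp_le)
    qed
    show "c (one - ?v - z) y \<le> 1" if "y \<in> Y" for y
      using that cv[OF that] A_D(3)[OF z that] vs A_D(2)[OF z] by (simp add: c_diff span_diff one_span c_one)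
    have "ht ?v = real (card I)"
      using A_D(5)[OF v] by (simp add: ht_sum vsp)
    then show "ht (one - ?v - z) = real (k + 1)"
      using vs A_D(2,5)[OF z] k assms(2) by (simp add: ht_diff span_diff one_span ht_one)
  qed
  define h where "h z' z = (\<Sum>s\<in>S. f z' * f z * (Xv (enc (0, s)) * W (one - ?v - z' - z - s)))" for z' z
  have "(\<Sum>z'\<in>A k. f z' * T (one - ?v - z')) = 0"
    by (simp add: T0)
  also have "(\<Sum>z'\<in>A k. f z' * T (one - ?v - z')) = (\<Sum>z'\<in>A k. \<Sum>z\<in>A k. h z' z)"
    unfolding T_def h_def by (simp add: sum_distrib_left mult.assoc)
  also have "\<dots> = (\<Sum>z\<in>A k. h z z)"
  proof (rule sum_symmetric_char_2[OF finite_A bser_double])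
    fix z z'
    have "one - ?v - z - z' - s = one - ?v - z' - z - s" for s
      by (simp add: algebra_simps)
    then show "h z z' = h z' z"
      unfolding h_def by (simp only: mult.commute[of "f z" "f z'"])
  qed
  finally show ?thesis
    by (simp add: h_def)
qed

text \<open>The root of the relation between squares. The complement of \<open>g\<close> is a sum of
  points of \<open>S\<close>, and each summand is used twice: of these \<open>2 * (m - k)\<close>
  points, \<open>m\<close> go to the vertices, one to the linear form and the others to the extra
  monomial of \<open>sum_squares_eq_0\<close>.\<close>

lemma kernel_pairing_eq_0:
  assumes g: "g \<in> A k"
  shows "(\<Sum>z\<in>A k. f z * W (g - z)) = 0"
proof -
  define m where "m = card Y"
  have "1 \<le> m - k" "one - g \<in> A (m - k)"
    using A_complement[OF g] k unfolding m_def by auto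
  from idp[OF this] obtain w :: "nat \<Rightarrow> 'q" where
    w: "\<And>i. i < m - k \<Longrightarrow> w i \<in> S" "one - g = (\<Sum>i<m - k. w i)"
    by blast
  define w2 where "w2 i = (if i < m - k then w i else w (i - (m - k)))" for i
  \<comment> \<open>\<open>2 * (k + 1) \<le> m\<close> makes the doubled list longer than
    \<open>m + 1\<close>; the indices after \<open>m\<close> number
    \<open>m - 2 * k - 1\<close>.\<close>
  define I where "I = {m + 1..<2 * (m - k)}"
  have w2: "w2 i \<in> S" if "i < 2 * (m - k)" for i
    using that w(1) by (auto simp: w2_def)
  have "(\<Sum>i<2 * (m - k). w2 i) = (\<Sum>i<m - k. w2 i) + (\<Sum>i\<in>{m - k..<m - k + (m - k)}. w2 i)"
    by (subst sum.union_disjoint[symmetric]) (auto intro!: sum.cong)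
  also have "(\<Sum>i\<in>{m - k..<m - k + (m - k)}. w2 i) = (\<Sum>i<m - k. w i)"
    by (rule sum.reindex_bij_witness[of _ "\<lambda>i. i + (m - k)" "\<lambda>i. i - (m - k)"]) (auto simp: w2_def)
  finally have sum_w2: "(\<Sum>i<2 * (m - k). w2 i) = (one - g) + (one - g)"
    by (simp add: w(2) w2_def)
  have "{..<2 * (m - k)} = {..<m} \<union> insert m I"
    using k by (auto simp: I_def m_def)
  then have "(\<Sum>i<2 * (m - k). w2 i) = (\<Sum>i\<in>{..<m} \<union> insert m I. w2 i)"
    by (simp only:)
  also have "\<dots> = (\<Sum>i<m. w2 i) + (\<Sum>i\<in>insert m I. w2 i)"
    by (rule sum.union_disjoint) (auto simp: I_def)
  also have "(\<Sum>i\<in>insert m I. w2 i) = w2 m + (\<Sum>i\<in>I. w2 i)"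
    by (rule sum.insert) (auto simp: I_def)
  finally have split: "(one - g) + (one - g) = (\<Sum>i<m. w2 i) + (w2 m + (\<Sum>i\<in>I. w2 i))"
    by (simp only: sum_w2)
  obtain b where b: "bij_betw b Y {..<m}"
    using ex_bij_betw_finite_nat[OF finite_Y] by (auto simp: m_def atLeast0LessThan)
  define u where "u y = w2 (b y)" for y
  have u: "u y \<in> S" if "y \<in> Y" for y
    using bij_betwE[OF b] that w2 k by (force simp: u_def m_def)
  have sum_u: "(\<Sum>y\<in>Y. u y) = (\<Sum>i<m. w2 i)"
    unfolding u_def by (rule sum.reindex_bij_betw[OF b])
  define s0 where "s0 = w2 m"
  have s0: "s0 \<in> S"
    unfolding s0_def using k by (intro w2) (simp add: m_def)
  obtain j t where t: "card Y = j + j + t" "t \<le> 1"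
    by (metis add.right_neutral even_two_times_div_two le_refl mult_2 odd_two_times_div_two_succ zero_le_one)
  let ?e = "\<Sum>y\<in>Y. Poly_Mapping.single (enc (y, u y)) 1 :: mono"
  \<comment> \<open>Selecting these exponents picks \<open>s0\<close> from the linear form and one
    point \<open>u y\<close> from each parameter.\<close>
  define e where "e = Poly_Mapping.single (enc (0, s0)) 1 + ?e"
  have e_le: "lk e i \<le> 1" for i
  proof -
    define u' where "u' y = (if y = 0 then s0 else u y)" for y
    have "inj_on (\<lambda>y. enc (y, u' y)) (insert 0 Y)"
    proof (rule inj_onI)
      fix x y
      assume *: "x \<in> insert 0 Y" "y \<in> insert 0 Y" "enc (x, u' x) = enc (y, u' y)"
      have "u' x \<in> S" "u' y \<in> S"
        using * s0 u by (auto simp: u'_def)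
      then show "x = y"
        using * enc_eq_iff by blast
    qed
    note lookup_sum_single_le_1[OF _ this, of i]
    moreover have "e = (\<Sum>y\<in>insert 0 Y. Poly_Mapping.single (enc (y, u' y)) 1)"
      unfolding e_def sum.insert[OF finite_Y zero_notin_Y]
      using zero_notin_Y by (intro arg_cong2[of _ _ _ _ plus] sum.cong) (auto simp: u'_def)
    ultimately show ?thesis
      using finite_Y by simp
  qed
  let ?q = "\<lambda>z s. one - (\<Sum>i\<in>I. w2 i) - z - z - s"
  have card_I: "card I = card Y - 2 * k - 1"
    using k by (simp add: I_def m_def)
  have wI: "w2 i \<in> S" if "i \<in> I" for i
    using that w2 by (simp add: I_def)
  have "0 = cartier e t (\<Sum>z\<in>A k. \<Sum>s\<in>S. f z * f z * (Xv (enc (0, s)) * W (?q z s)))"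
    using sum_squares_eq_0[OF _ card_I wI] by (simp add: I_def)
  also have "\<dots> = (\<Sum>z\<in>A k. \<Sum>s\<in>S. f z * cartier e t (Xv (enc (0, s)) * W (?q z s)))"
    by (simp only: cartier_sum cartier_square_mult[OF e_le t(2)])
  also have "\<dots> = (\<Sum>z\<in>A k. \<Sum>s\<in>S. if s = s0 then f z * cartier ?e t (W (?q z s0)) else 0)"
    unfolding e_def by (intro sum.cong refl) (simp add: cartier_var_mult_W[OF s0] del: One_nat_def)
  also have "\<dots> = (\<Sum>z\<in>A k. f z * cartier ?e t (W (?q z s0)))"
    using s0 finite_A[of 1] by simp
  also have "\<dots> = (\<Sum>z\<in>A k. f z * (fps_X ^ j * W (g - z)))"
  proof (intro sum.cong refl arg_cong2[where f = times])
    fix z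
    \<comment> \<open>Here the doubling pays off: apart from the weight of the selected variables,
      what is left is twice \<open>g - z\<close>.\<close>
    have "one - (\<Sum>i\<in>I. w2 i) - w2 m = g + g - one + (\<Sum>i<m. w2 i)"
      using split by (simp add: algebra_simps)
    then have "?q z s0 = (g - z) + (g - z) + (\<Sum>y\<in>Y. u y - y)"
      by (simp add: s0_def sum_subtractf sum_u one_def algebra_simps)
    then show "cartier ?e t (W (?q z s0)) = fps_X ^ j * W (g - z)"
      by (intro cartier_W u t)
  qed
  also have "\<dots> = fps_X ^ j * (\<Sum>z\<in>A k. f z * W (g - z))"
    by (simp add: sum_distrib_left mult_ac)
  \<comment> \<open>The power of \<tau> can be cancelled, as there are no zero divisors.\<close>
  finally show ?thesis
    by simp
qed

text \<open>Modulo \<tau> the pairing relation at \<open>g\<close> reads \<open>f g = 0\<close>;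
  once all coefficients below \<open>n\<close> vanish, the same argument applies to the coefficient
  at \<open>n\<close>.\<close>

lemma kernel_trivial:
  assumes "g \<in> A k"
  shows "f g = 0"
proof -
  have "\<forall>g\<in>A k. fps_nth (f g) n = 0" for n
  proof (induction n rule: less_induct)
    case (less n)
    show ?case
    proof
      fix g
      assume g: "g \<in> A k"
      have "fps_nth (f z * W (g - z)) n = (if z = g then fps_nth (f g) n else 0)" if "z \<in> A k" for z
      proof -
        have "fps_nth (f z * W (g - z)) n = (\<Sum>i=0..n. fps_nth (f z) i * fps_nth (W (g - z)) (n - i))"
          by (rule fps_mult_nth)
        also have "\<dots> = (\<Sum>i=0..n. if i = n then fps_nth (f z) n * fps_nth (W (g - z)) 0 else 0)"
          using less that by (intro sum.cong refl) auto
        finally show ?thesis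
          by (simp add: fps_nth_W_0)
      qed
      then have "fps_nth (\<Sum>z\<in>A k. f z * W (g - z)) n = fps_nth (f g) n"
        using g finite_A by (simp add: fps_sum_nth)
      then show "fps_nth (f g) n = 0"
        by (simp add: kernel_pairing_eq_0[OF g])
    qed
  qed
  then show ?thesis
    using assms by (intro fps_ext) simp
qed

end

end

lemma (in idp_simplex) card_A_mono:
  assumes "2 * (k + 1) \<le> card Y"
  shows "card (A k) \<le> card (A (k + 1))"
proof (rule ccontr)
  obtain enc :: "'q \<times> 'q \<Rightarrow> nat" where "inj_on enc (insert 0 Y \<times> A 1)"
    using finite_imp_inj_to_nat_seg[of "insert 0 Y \<times> A 1"] finite_Y finite_A by auto
  then interpret idp_simplex_vars Y L enc
    by unfold_locales
  assume "\<not> card (A k) \<le> card (A (k + 1))"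
  then have "card (A (k + 1)) < card (A k)"
    by simp
  \<comment> \<open>The matrix of multiplication by the generic linear form, with one row for each
    point whose complement is paired with the product.\<close>
  from exists_kernel_vector[OF finite_A finite_A this, of "\<lambda>g z. \<Sum>s\<in>A 1. Xv (enc (0, s)) * W (g - z - s)"]
  obtain f where f: "\<exists>z\<in>A k. f z \<noteq> 0"
    "\<forall>g\<in>A (k + 1). (\<Sum>z\<in>A k. (\<Sum>s\<in>A 1. Xv (enc (0, s)) * W (g - z - s)) * f z) = 0"
    by blast
  have "f z = 0" if "z \<in> A k" for z
    by (rule kernel_trivial[OF assms _ that]) (use f(2) in \<open>simp add: sum_distrib_left sum_distrib_right mult_ac\<close>)
  then show False
    using f(1) by blast
qed

section \<open>Lattices\<close>

lemma lattice_bounded_finite: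
  assumes "lattice_basis B M" "bounded S"
  shows "finite (M \<inter> S)"
proof -
  from assms have B: "finite B" "independent B" "M = {(\<Sum>b\<in>B. of_int (c b) *\<^sub>R b) | c :: 'a \<Rightarrow> int. True}"
    by (auto simp: lattice_basis_def)
  obtain R where R: "\<And>x. x \<in> S \<Longrightarrow> norm x \<le> R"
    using assms(2) bounded_iff by blast
  have "\<exists>K::real. \<forall>x c. x \<in> S \<longrightarrow> x = (\<Sum>b\<in>B. of_int (c b) *\<^sub>R b) \<longrightarrow> \<bar>of_int (c b')\<bar> \<le> K" if b': "b' \<in> B" for b'
  proof -
    \<comment> \<open>Coordinate functionals of \<open>B\<close> extend to the ambient space and are
      bounded there, so bounded sets have bounded integer coordinates.\<close>
    obtain g where g: "linear g" "\<And>b. b \<in> B \<Longrightarrow> g b = (if b = b' then 1 else 0 :: real)"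
      using linear_independent_extend[OF B(2), of "\<lambda>b. if b = b' then 1 else 0"] by auto
    obtain K where K: "\<And>x. norm (g x) \<le> norm x * K" "0 \<le> K"
      using bounded_linear.nonneg_bounded[of g] g(1) by (auto simp: linear_conv_bounded_linear)
    have "\<bar>of_int (c b')\<bar> \<le> R * K" if "x \<in> S" "x = (\<Sum>b\<in>B. of_int (c b) *\<^sub>R b)" for x c
    proof -
      have "g x = (\<Sum>b\<in>B. of_int (c b) * g b)"
        unfolding that(2) by (simp add: linear_sum[OF g(1)] linear_scale[OF g(1)])
      also have "\<dots> = (\<Sum>b\<in>B. if b = b' then of_int (c b) else 0)"
        by (intro sum.cong) (auto simp: g)
      also have "\<dots> = of_int (c b')"
        using B b' by simp
      finally have "\<bar>of_int (c b')\<bar> = norm (g x)"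
        by simp
      also have "\<dots> \<le> norm x * K"
        by (rule K)
      also have "\<dots> \<le> R * K"
        using R that K by (intro mult_right_mono) auto
      finally show ?thesis .
    qed
    then show ?thesis
      by blast
  qed
  then obtain K :: "'a \<Rightarrow> real" where K: "\<And>b x c. b \<in> B \<Longrightarrow> x \<in> S \<Longrightarrow> x = (\<Sum>b\<in>B. of_int (c b) *\<^sub>R b) \<Longrightarrow> \<bar>of_int (c b)\<bar> \<le> K b"
    by metis
  have "M \<inter> S \<subseteq> (\<lambda>c. \<Sum>b\<in>B. of_int (c b) *\<^sub>R b) ` (Pi\<^sub>E B (\<lambda>b. {\<lfloor>- K b\<rfloor>..\<lceil>K b\<rceil>}))"
  proof
    fix x
    assume x: "x \<in> M \<inter> S"
    then obtain c where c: "x = (\<Sum>b\<in>B. of_int (c b) *\<^sub>R b)"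
      by (auto simp: B)
    have "\<lfloor>- K b\<rfloor> \<le> c b \<and> c b \<le> \<lceil>K b\<rceil>" if "b \<in> B" for b
      using K[OF that _ c] x by (simp add: abs_le_iff) linarith
    then have "restrict c B \<in> Pi\<^sub>E B (\<lambda>b. {\<lfloor>- K b\<rfloor>..\<lceil>K b\<rceil>})"
      by auto
    moreover have "x = (\<Sum>b\<in>B. of_int (restrict c B b) *\<^sub>R b)"
      using c by simp
    ultimately show "x \<in> (\<lambda>c. \<Sum>b\<in>B. of_int (c b) *\<^sub>R b) ` (Pi\<^sub>E B (\<lambda>b. {\<lfloor>- K b\<rfloor>..\<lceil>K b\<rceil>}))"
      by blast
  qed
  then show ?thesis
    by (rule finite_subset) (intro finite_imageI finite_PiE B finite_atLeastAtMost_int)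
qed

lemma lattice_mem_iff:
  "lattice_basis B M \<Longrightarrow> x \<in> M \<longleftrightarrow> (\<exists>c. x = (\<Sum>b\<in>B. of_int (c b) *\<^sub>R b))"
  by (auto simp: lattice_basis_def)

lemma lattice_0: "lattice_basis B M \<Longrightarrow> 0 \<in> M"
  by (auto simp: lattice_mem_iff intro!: exI[of _ "\<lambda>_. 0"])

lemma lattice_add:
  assumes "lattice_basis B M" "x \<in> M" "y \<in> M"
  shows "x + y \<in> M"
proof -
  from assms obtain c d where "x = (\<Sum>b\<in>B. of_int (c b) *\<^sub>R b)" "y = (\<Sum>b\<in>B. of_int (d b) *\<^sub>R b)"
    by (auto simp: lattice_mem_iff)
  then show ?thesis
    unfolding lattice_mem_iff[OF assms(1)]
    by (intro exI[of _ "\<lambda>b. c b + d b"]) (simp add: sum.distrib scaleR_add_left)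
qed

lemma lattice_diff:
  assumes "lattice_basis B M" "x \<in> M" "y \<in> M"
  shows "x - y \<in> M"
proof -
  from assms obtain c d where "x = (\<Sum>b\<in>B. of_int (c b) *\<^sub>R b)" "y = (\<Sum>b\<in>B. of_int (d b) *\<^sub>R b)"
    by (auto simp: lattice_mem_iff)
  then show ?thesis
    unfolding lattice_mem_iff[OF assms(1)]
    by (intro exI[of _ "\<lambda>b. c b - d b"]) (simp add: sum_subtractf scaleR_diff_left)
qed

section \<open>Bases of discrete subgroups\<close>

definition add_subgroup :: "'b::ab_group_add set \<Rightarrow> bool" where
  "add_subgroup N \<longleftrightarrow> 0 \<in> N \<and> (\<forall>x\<in>N. \<forall>y\<in>N. x + y \<in> N \<and> x - y \<in> N)"

lemma add_subgroup_nat_scale: "add_subgroup N \<Longrightarrow> (x::'b::real_vector) \<in> N \<Longrightarrow> real n *\<^sub>R x \<in> N"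
  by (induction n) (auto simp: add_subgroup_def scaleR_add_left)

lemma add_subgroup_int_scale:
  assumes "add_subgroup N" "(x::'b::real_vector) \<in> N"
  shows "of_int k *\<^sub>R x \<in> N"
proof (cases "k \<ge> 0")
  case True
  then show ?thesis
    using add_subgroup_nat_scale[OF assms, of "nat k"] by simp
next
  case False
  then have "of_int k *\<^sub>R x = 0 - real (nat (- k)) *\<^sub>R x"
    by simp
  then show ?thesis
    using add_subgroup_nat_scale[OF assms, of "nat (- k)"] assms(1) unfolding add_subgroup_def by metis
qed

lemma add_subgroup_sum: "add_subgroup N \<Longrightarrow> (\<And>i. i \<in> I \<Longrightarrow> x i \<in> N) \<Longrightarrow> (\<Sum>i\<in>I. x i) \<in> N"
  by (induction I rule: infinite_finite_induct) (auto simp: add_subgroup_def)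

lemma add_subgroup_Int: "add_subgroup N \<Longrightarrow> add_subgroup N' \<Longrightarrow> add_subgroup (N \<inter> N')"
  by (auto simp: add_subgroup_def)

lemma add_subgroup_subspace: "subspace W \<Longrightarrow> add_subgroup W"
  by (auto simp: add_subgroup_def subspace_def subspace_diff)

lemma add_subgroup_lattice: "lattice_basis B M \<Longrightarrow> add_subgroup M"
  by (auto simp: add_subgroup_def intro: lattice_0 lattice_add lattice_diff)

text \<open>Induction on the dimension: an element \<open>g\<close> with least positive coordinate
  at \<open>u\<close> generates \<open>N\<close> together with the part of \<open>N\<close> in the
  span of the other vectors.\<close>

lemma discrete_subgroup_has_basis:
  fixes N :: "'a::euclidean_space set"
  assumes "finite U" "independent U" "U \<subseteq> N" "N \<subseteq> span U" "add_subgroup N"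
    and "\<And>S. bounded S \<Longrightarrow> finite (N \<inter> S)"
  shows "\<exists>B. lattice_basis B N"
  using assms
proof (induction U arbitrary: N rule: finite_induct)
  case empty
  then have "N = {0}"
    by (auto simp: add_subgroup_def)
  then have "lattice_basis {} N"
    by (auto simp: lattice_basis_def independent_empty)
  then show ?case ..
next
  case (insert u U)
  let ?c = "representation (insert u U)"
  note indep = insert.prems(1) and N = insert.prems(4)
  have finU: "finite (insert u U)"
    using insert by simp
  have indU: "independent U"
    using indep by (meson dependent_mono subset_insertI)
  have Nspan: "x \<in> span (insert u U)" if "x \<in> N" for x
    using insert.prems(3) that by blast
  have uu: "u \<in> insert u U" "u \<in> N" "\<And>v. v \<in> U \<Longrightarrow> v \<in> N"
    using insert.prems(2) by auto
  have sum_c: "x = (\<Sum>v\<in>insert u U. ?c x v *\<^sub>R v)" if "x \<in> span (insert u U)" for x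
    using sum_representation_eq[OF indep that finU order.refl] by simp
  have c_diff: "?c (x - x') v = ?c x v - ?c x' v" if "x \<in> span (insert u U)" "x' \<in> span (insert u U)" for x x' v
    using representation_diff[OF indep that(2,1)] by simp
  have c_scale: "?c (r *\<^sub>R x) v = r * ?c x v" if "x \<in> span (insert u U)" for x r v
    using representation_scale[OF indep that] by simp
  have c_basis: "?c w v = (if v = w then 1 else 0)" if "w \<in> insert u U" for v w
    using representation_basis[OF indep that] by simp
  \<comment> \<open>Confining the coordinates to a bounded range makes the set finite, so a minimum
    exists; the bound 1 is included so that \<open>u\<close> itself belongs to it.\<close>
  define Pos where "Pos = {x \<in> N. 0 < ?c x u \<and> ?c x u \<le> 1 \<and> (\<forall>v\<in>U. 0 \<le> ?c x v \<and> ?c x v \<le> 1)}"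
  have "finite Pos"
  proof (rule finite_subset)
    show "Pos \<subseteq> N \<inter> cball 0 (\<Sum>v\<in>insert u U. norm v)"
    proof
      fix x
      assume x: "x \<in> Pos"
      have "norm (\<Sum>v\<in>insert u U. ?c x v *\<^sub>R v) \<le> (\<Sum>v\<in>insert u U. norm v)"
      proof (rule sum_norm_le)
        fix v
        assume "v \<in> insert u U"
        then have "\<bar>?c x v\<bar> \<le> 1"
          using x by (auto simp: Pos_def)
        then show "norm (?c x v *\<^sub>R v) \<le> norm v"
          by (simp add: mult_left_le_one_le)
      qed
      then show "x \<in> N \<inter> cball 0 (\<Sum>v\<in>insert u U. norm v)"
        using x sum_c[OF Nspan, of x] by (auto simp: Pos_def)
    qed
  qed (use insert.prems(5) in auto)
  moreover have "u \<in> Pos"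
    using uu insert.hyps by (auto simp: Pos_def c_basis)
  ultimately have "finite ((\<lambda>x. ?c x u) ` Pos)" "(\<lambda>x. ?c x u) ` Pos \<noteq> {}"
    by auto
  then obtain g where g: "g \<in> Pos" "\<And>x. x \<in> Pos \<Longrightarrow> ?c g u \<le> ?c x u"
    using Min_in[of "(\<lambda>x. ?c x u) ` Pos"] Min_le[of "(\<lambda>x. ?c x u) ` Pos"]
    by (metis (no_types, lifting) image_iff)
  define \<delta> where "\<delta> = ?c g u"
  have gN: "g \<in> N" and \<delta>: "0 < \<delta>" "\<delta> \<le> 1"
    using g by (auto simp: Pos_def \<delta>_def)
  have dec: "\<exists>m::int. x - of_int m *\<^sub>R g \<in> N \<inter> span U" if x: "x \<in> N" for x
  proof -
    define m where "m = \<lfloor>?c x u / \<delta>\<rfloor>"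
    define x1 where "x1 = x - of_int m *\<^sub>R g"
    have x1: "x1 \<in> N"
      using x gN N add_subgroup_int_scale[OF N gN] by (auto simp: add_subgroup_def x1_def)
    have cx1: "?c x1 u = ?c x u - of_int m * \<delta>"
      using x gN by (simp add: x1_def c_diff c_scale Nspan span_scale \<delta>_def)
    have "of_int m \<le> ?c x u / \<delta>" "?c x u / \<delta> < of_int m + 1"
      by (auto simp: m_def)
    then have rng: "0 \<le> ?c x1 u" "?c x1 u < \<delta>"
      using \<delta> by (auto simp: cx1 field_simps)
    \<comment> \<open>A remainder with positive coordinate at \<open>u\<close> would, after reducing
      its other coordinates, be an element of \<open>Pos\<close> below the minimum.\<close>
    define x2 where "x2 = x1 - (\<Sum>v\<in>U. of_int \<lfloor>?c x1 v\<rfloor> *\<^sub>R v)"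
    have s: "(\<Sum>v\<in>U. of_int \<lfloor>?c x1 v\<rfloor> *\<^sub>R v) \<in> N"
      using N uu(3) by (intro add_subgroup_sum add_subgroup_int_scale)
    have x2: "x2 \<in> N"
      using x1 s N by (auto simp: add_subgroup_def x2_def)
    have "?c (\<Sum>v\<in>U. of_int \<lfloor>?c x1 v\<rfloor> *\<^sub>R v) w = (\<Sum>v\<in>U. if w = v then of_int \<lfloor>?c x1 v\<rfloor> else 0)" for w
      by (subst representation_sum[OF indep])
         (auto intro!: span_scale sum.cong simp: span_base c_scale c_basis)
    then have cx2: "?c x2 w = ?c x1 w - (if w \<in> U then of_int \<lfloor>?c x1 w\<rfloor> else 0)" for w
      using Nspan x1 s insert.hyps by (simp add: x2_def c_diff)
    have "?c x1 u = 0"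
    proof (rule ccontr)
      assume "?c x1 u \<noteq> 0"
      moreover have "0 \<le> ?c x2 v \<and> ?c x2 v \<le> 1" if "v \<in> U" for v
        using that unfolding cx2 by simp linarith
      ultimately have "x2 \<in> Pos"
        using rng \<delta> x2 insert.hyps by (auto simp: Pos_def cx2)
      then show False
        using g(2)[of x2] rng insert.hyps by (simp add: cx2 \<delta>_def)
    qed
    then have "x1 = (\<Sum>v\<in>U. ?c x1 v *\<^sub>R v)"
      using sum_c[OF Nspan[OF x1]] insert.hyps by simp
    moreover have "(\<Sum>v\<in>U. ?c x1 v *\<^sub>R v) \<in> span U"
      by (intro span_sum span_scale span_base)
    ultimately show ?thesis
      using x1 by (auto simp: x1_def intro!: exI[of _ m])
  qed
  have "\<exists>B. lattice_basis B (N \<inter> span U)"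
  proof (rule insert.IH)
    show "add_subgroup (N \<inter> span U)"
      by (rule add_subgroup_Int[OF N add_subgroup_subspace[OF subspace_span]])
    show "finite (N \<inter> span U \<inter> S)" if "bounded S" for S
      by (rule finite_subset[OF _ insert.prems(5)[OF that]]) auto
  qed (use indU uu in \<open>auto simp: span_base\<close>)
  then obtain B where B: "lattice_basis B (N \<inter> span U)"
    by blast
  then have B': "finite B" "independent B" "N \<inter> span U = {(\<Sum>b\<in>B. of_int (c b) *\<^sub>R b) | c :: 'a \<Rightarrow> int. True}"
    by (auto simp: lattice_basis_def)
  have B_sub: "B \<subseteq> N \<inter> span U"
  proof
    fix b
    assume b: "b \<in> B"
    have "b = (\<Sum>b'\<in>B. of_int (if b' = b then 1 else 0) *\<^sub>R b')"
      using b B'(1) by (simp add: if_distrib if_distribR cong: if_cong)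
    then show "b \<in> N \<inter> span U"
      unfolding B'(3) by (intro CollectI exI[of _ "\<lambda>b'. if b' = b then 1 else 0"]) auto
  qed
  have g_notin: "g \<notin> span U"
  proof
    assume "g \<in> span U"
    then have "?c g = representation U g"
      by (intro representation_extend[OF indep]) auto
    then have "?c g u = 0"
      using representation_ne_zero[of U g u] insert.hyps by auto
    then show False
      using \<delta> by (simp add: \<delta>_def)
  qed
  have span_B: "span B \<subseteq> span U"
    using B_sub by (intro span_minimal) auto
  have gB: "g \<notin> B"
    using g_notin B_sub by blast
  have "lattice_basis (insert g B) N"
    unfolding lattice_basis_def
  proof (intro conjI)
    show "independent (insert g B)"
      using g_notin span_B B'(2) by (intro independent_insertI) auto
    show "N = {(\<Sum>b\<in>insert g B. of_int (c b) *\<^sub>R b) | c :: 'a \<Rightarrow> int. True}"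
    proof (intro set_eqI iffI)
      fix x
      assume "x \<in> N"
      from dec[OF this] obtain m :: int and c where "x - of_int m *\<^sub>R g = (\<Sum>b\<in>B. of_int (c b) *\<^sub>R b)"
        unfolding B'(3) by auto
      then have "x = of_int m *\<^sub>R g + (\<Sum>b\<in>B. of_int (c b) *\<^sub>R b)"
        by (simp add: algebra_simps)
      also have "\<dots> = (\<Sum>b\<in>insert g B. of_int ((c(g := m)) b) *\<^sub>R b)"
        using gB B'(1) by (auto intro!: sum.cong)
      finally show "x \<in> {(\<Sum>b\<in>insert g B. of_int (c b) *\<^sub>R b) | c :: 'a \<Rightarrow> int. True}"
        by blast
    next
      fix x
      assume "x \<in> {(\<Sum>b\<in>insert g B. of_int (c b) *\<^sub>R b) | c :: 'a \<Rightarrow> int. True}"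
      then show "x \<in> N"
        using gN B_sub by (auto intro!: add_subgroup_sum[OF N] add_subgroup_int_scale[OF N])
    qed
  qed (use B'(1) in simp)
  then show ?case ..
qed

text \<open>This guarantees that the basis chosen in \<open>normalized_volume\<close>
  exists.\<close>

lemma lattice_Int_subspace:
  assumes "lattice_basis B M" "subspace W"
  shows "\<exists>B'. lattice_basis B' (M \<inter> W)"
proof -
  obtain U where U: "U \<subseteq> M \<inter> W" "independent U" "M \<inter> W \<subseteq> span U" "card U = dim (M \<inter> W)"
    using basis_exists[of "M \<inter> W"] by blast
  show ?thesis
  proof (rule discrete_subgroup_has_basis)
    show "add_subgroup (M \<inter> W)"
      by (rule add_subgroup_Int[OF add_subgroup_lattice[OF assms(1)] add_subgroup_subspace[OF assms(2)]])
    show "finite (M \<inter> W \<inter> S)" if "bounded S" for S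
      by (rule finite_subset[OF _ lattice_bounded_finite[OF assms(1) that]]) auto
  qed (use U in \<open>auto intro: independent_imp_finite\<close>)
qed

section \<open>The cone over a lattice simplex\<close>

locale vertex_simplex =
  fixes M E :: "'a::euclidean_space set" and B\<^sub>0 :: "'a set"
  assumes lattice: "lattice_basis B\<^sub>0 M" and finite_E: "finite E" and E_nonempty: "E \<noteq> {}"
    and aff_indep: "\<not> affine_dependent E" and E_subset: "E \<subseteq> M"
begin

definition Y :: "('a \<times> real) set" where "Y = (\<lambda>v. (v, 1)) ` E"

lemma inj_lift: "inj_on (\<lambda>v. (v, 1::real)) E"
  by (rule inj_onI) simp

lemma card_Y: "card Y = card E"
  unfolding Y_def by (rule card_image) (rule inj_lift)

lemma sum_Y: "(\<Sum>y\<in>Y. g y) = (\<Sum>v\<in>E. g (v, 1))"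
  unfolding Y_def by (subst sum.reindex[OF inj_lift]) simp

sublocale finite_basis Y
proof
  show fin: "finite Y"
    unfolding Y_def using finite_E by simp
  show "independent Y"
  proof
    assume "dependent Y"
    then obtain u where u: "\<exists>y\<in>Y. u y \<noteq> 0" "(\<Sum>y\<in>Y. u y *\<^sub>R y) = 0"
      using dependent_finite[OF fin] by blast
    have "(\<Sum>v\<in>E. u (v, 1) *\<^sub>R (v, 1::real)) = 0"
      using u(2) by (simp only: sum_Y)
    then have "(\<Sum>v\<in>E. u (v, 1) *\<^sub>R v) = 0" "(\<Sum>v\<in>E. u (v, 1)) = 0"
      by (auto simp: prod_eq_iff fst_sum snd_sum)
    moreover have "\<exists>v\<in>E. u (v, 1) \<noteq> 0"
      using u(1) by (auto simp: Y_def)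
    ultimately show False
      using aff_indep affine_dependent_explicit_finite[OF finite_E]
      by (metis (no_types, lifting) sum.cong)
  qed
qed

lemma fst_Y: "y \<in> Y \<Longrightarrow> fst y \<in> M" and snd_Y: "y \<in> Y \<Longrightarrow> snd y = 1"
  using E_subset by (auto simp: Y_def)

lemma ht_eq_snd:
  assumes "x \<in> span Y"
  shows "ht x = snd x"
proof -
  have "snd x = (\<Sum>y\<in>Y. c x y * snd y)"
    by (subst sum_c[OF assms, symmetric]) (simp add: snd_sum)
  also have "\<dots> = ht x"
    by (simp add: ht_def snd_Y)
  finally show ?thesis ..
qed

lemma norm_fst_le:
  assumes "x \<in> span Y" "\<And>y. y \<in> Y \<Longrightarrow> \<bar>c x y\<bar> \<le> r"
  shows "norm (fst x) \<le> r * (\<Sum>y\<in>Y. norm (fst y))"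
proof -
  have "norm (fst x) = norm (\<Sum>y\<in>Y. c x y *\<^sub>R fst y)"
    by (subst sum_c[OF assms(1), symmetric]) (simp add: fst_sum)
  also have "\<dots> \<le> (\<Sum>y\<in>Y. r * norm (fst y))"
    using assms(2) by (intro sum_norm_le) (simp add: mult_right_mono)
  finally show ?thesis
    by (simp add: sum_distrib_left)
qed

definition H :: "('a \<times> real) set" where
  "H = {x \<in> span Y. fst x \<in> M \<and> snd x \<in> \<int>}"

lemma H_span: "x \<in> H \<Longrightarrow> x \<in> span Y"
  by (simp add: H_def)

lemma Y_H: "y \<in> Y \<Longrightarrow> y \<in> H"
  by (simp add: H_def span_Y fst_Y snd_Y)

lemma add_subgroup_H: "add_subgroup H"
  using lattice_0[OF lattice] lattice_add[OF lattice] lattice_diff[OF lattice]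
  by (auto simp: add_subgroup_def H_def span_zero span_add span_diff)

lemma H_add: "x \<in> H \<Longrightarrow> x' \<in> H \<Longrightarrow> x + x' \<in> H" and H_diff: "x \<in> H \<Longrightarrow> x' \<in> H \<Longrightarrow> x - x' \<in> H"
  and H_0: "0 \<in> H"
  using add_subgroup_H by (auto simp: add_subgroup_def)

lemma finite_H_height:
  "finite {x \<in> H. snd x = t \<and> (\<forall>y\<in>Y. \<bar>c x y\<bar> \<le> r)}"
proof (rule finite_subset)
  show "{x \<in> H. snd x = t \<and> (\<forall>y\<in>Y. \<bar>c x y\<bar> \<le> r)}
    \<subseteq> (\<lambda>x. (x, t)) ` (M \<inter> cball 0 (r * (\<Sum>y\<in>Y. norm (fst y))))"
    using norm_fst_le by (auto simp: H_def image_iff prod_eq_iff)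
  show "finite ((\<lambda>x. (x, t)) ` (M \<inter> cball 0 (r * (\<Sum>y\<in>Y. norm (fst y)))))"
    by (intro finite_imageI lattice_bounded_finite[OF lattice]) simp
qed

text \<open>Lattice points of height \<open>n\<close> in the cone over the simplex whose coordinates at the vertices
  in \<open>Z\<close> are less than one: this interpolates between the dilate (\<open>Z = {}\<close>) and the half-open
  fundamental parallelepiped (\<open>Z = Y\<close>), and each step removes one factor \<open>1 / (1 - t)\<close>.\<close>

definition cone_pts :: "('a \<times> real) set \<Rightarrow> nat \<Rightarrow> ('a \<times> real) set" where
  "cone_pts Z n = {x \<in> H. snd x = real n \<and> (\<forall>y\<in>Y. 0 \<le> c x y) \<and> (\<forall>y\<in>Z. c x y < 1)}"

lemma finite_cone: "finite (cone_pts Z n)"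
proof (rule finite_subset[OF _ finite_H_height])
  show "cone_pts Z n \<subseteq> {x \<in> H. snd x = real n \<and> (\<forall>y\<in>Y. \<bar>c x y\<bar> \<le> real n)}"
  proof
    fix x
    assume x: "x \<in> cone_pts Z n"
    have "c x y \<le> real n" if "y \<in> Y" for y
    proof -
      have "c x y \<le> ht x"
        unfolding ht_def using x that finite_Y by (intro member_le_sum) (auto simp: cone_pts_def)
      then show ?thesis
        using x ht_eq_snd[of x] by (simp add: cone_pts_def H_span)
    qed
    then show "x \<in> {x \<in> H. snd x = real n \<and> (\<forall>y\<in>Y. \<bar>c x y\<bar> \<le> real n)}"
      using x by (auto simp: cone_pts_def)
  qed
qed

lemma cone_insert_0:
  assumes "y \<in> Y"
  shows "cone_pts (insert y Z) 0 = cone_pts Z 0"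
proof -
  have "c x y < 1" if "x \<in> cone_pts Z 0" for x
  proof -
    have "c x y \<le> ht x"
      unfolding ht_def using that assms finite_Y by (intro member_le_sum) (auto simp: cone_pts_def)
    then show ?thesis
      using that ht_eq_snd[of x] by (simp add: cone_pts_def H_span)
  qed
  then show ?thesis
    by (auto simp: cone_pts_def)
qed

text \<open>Translation by \<open>y\<close> identifies the cone points one level lower with those
  whose coordinate at \<open>y\<close> is at least one.\<close>

lemma card_cone_Suc:
  assumes y: "y \<in> Y" "y \<notin> Z" "Z \<subseteq> Y"
  shows "card (cone_pts Z (Suc n)) = card (cone_pts (insert y Z) (Suc n)) + card (cone_pts Z n)"
proof -
  have "(\<lambda>x. x + y) ` cone_pts Z n = {x \<in> cone_pts Z (Suc n). 1 \<le> c x y}"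
  proof (intro equalityI subsetI)
    fix x
    assume "x \<in> (\<lambda>x. x + y) ` cone_pts Z n"
    then show "x \<in> {x \<in> cone_pts Z (Suc n). 1 \<le> c x y}"
      using y by (auto simp: cone_pts_def H_add Y_H snd_Y c_add H_span span_Y c_basis subset_iff)
  next
    fix x
    assume x: "x \<in> {x \<in> cone_pts Z (Suc n). 1 \<le> c x y}"
    then have "x - y \<in> cone_pts Z n"
      using y by (auto simp: cone_pts_def H_diff Y_H snd_Y c_diff H_span span_Y c_basis subset_iff)
    then show "x \<in> (\<lambda>x. x + y) ` cone_pts Z n"
      by (intro image_eqI[of _ _ "x - y"]) auto
  qed
  moreover have "card ((\<lambda>x. x + y) ` cone_pts Z n) = card (cone_pts Z n)"
    by (rule card_image) simp
  ultimately have "card {x \<in> cone_pts Z (Suc n). 1 \<le> c x y} = card (cone_pts Z n)"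
    by simp
  moreover have "cone_pts Z (Suc n) = cone_pts (insert y Z) (Suc n) \<union> {x \<in> cone_pts Z (Suc n). 1 \<le> c x y}"
    using y by (auto simp: cone_pts_def)
  moreover have "card (cone_pts (insert y Z) (Suc n) \<union> {x \<in> cone_pts Z (Suc n). 1 \<le> c x y})
      = card (cone_pts (insert y Z) (Suc n)) + card {x \<in> cone_pts Z (Suc n). 1 \<le> c x y}"
    by (rule card_Un_disjoint[OF finite_cone finite_subset[OF _ finite_cone[of Z "Suc n"]]])
      (auto simp: cone_pts_def)
  ultimately show ?thesis
    by simp
qed

definition cone_series :: "('a \<times> real) set \<Rightarrow> int fps" where
  "cone_series Z = Abs_fps (\<lambda>n. int (card (cone_pts Z n)))"

lemma cone_series_insert:
  assumes y: "y \<in> Y" "y \<notin> Z" "Z \<subseteq> Y"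
  shows "cone_series (insert y Z) = cone_series Z * (1 - fps_X)"
proof (rule fps_ext)
  fix n
  show "fps_nth (cone_series (insert y Z)) n = fps_nth (cone_series Z * (1 - fps_X)) n"
    using card_cone_Suc[OF y] cone_insert_0[OF y(1)]
    by (cases n) (simp_all add: cone_series_def right_diff_distrib)
qed

lemma cone_series_eq:
  assumes "Z \<subseteq> Y"
  shows "cone_series Z = cone_series {} * (1 - fps_X) ^ card Z"
  using finite_subset[OF assms finite_Y] assms
proof (induction Z rule: finite_induct)
  case (insert y Z)
  then show ?case
    by (simp add: cone_series_insert mult_ac)
qed simp

section \<open>Dilates of the simplex and the h*-vector\<close>

definition \<Delta> :: "'a set" where "\<Delta> = convex hull E"

lemma \<Delta>_iff: "x \<in> \<Delta> \<longleftrightarrow> (\<exists>u. (\<forall>v\<in>E. 0 \<le> u v) \<and> sum u E = 1 \<and> (\<Sum>v\<in>E. u v *\<^sub>R v) = x)"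
  unfolding \<Delta>_def by (simp add: convex_hull_finite[OF finite_E])

lemma mem_span_iff: "x \<in> span Y \<longleftrightarrow> (\<exists>u. x = (\<Sum>v\<in>E. u v *\<^sub>R (v, 1)))"
proof
  assume "x \<in> span Y"
  then have "x = (\<Sum>v\<in>E. c x (v, 1) *\<^sub>R (v, 1))"
    using sum_c[of x] by (simp only: sum_Y)
  then show "\<exists>u. x = (\<Sum>v\<in>E. u v *\<^sub>R (v, 1))"
    by (intro exI[of _ "\<lambda>v. c x (v, 1)"])
next
  assume "\<exists>u. x = (\<Sum>v\<in>E. u v *\<^sub>R (v, 1))"
  then obtain u where x: "x = (\<Sum>v\<in>E. u v *\<^sub>R (v, 1))"
    by blast
  show "x \<in> span Y"
    unfolding x by (intro span_sum span_scale span_base) (simp add: Y_def)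
qed

lemma c_combination_E:
  assumes "v \<in> E"
  shows "c (\<Sum>v\<in>E. u v *\<^sub>R (v, 1)) (v, 1) = u v"
  using c_combination[of "(v, 1)" "\<lambda>y. u (fst y)"] assms by (simp add: sum_Y) (simp add: Y_def)

lemma dilate_iff:
  "x \<in> dilate n \<Delta> \<longleftrightarrow> (x, real n) \<in> span Y \<and> (\<forall>y\<in>Y. 0 \<le> c (x, real n) y)"
proof
  assume "x \<in> dilate n \<Delta>"
  then obtain u where u: "\<forall>v\<in>E. 0 \<le> u v" "sum u E = 1" "x = real n *\<^sub>R (\<Sum>v\<in>E. u v *\<^sub>R v)"
    by (auto simp: dilate_def \<Delta>_iff)
  have "(x, real n) = (\<Sum>v\<in>E. (real n * u v) *\<^sub>R (v, 1))"
    using u by (simp add: prod_eq_iff fst_sum snd_sum scaleR_sum_right sum_distrib_left[symmetric])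
  note x = this
  have "(x, real n) \<in> span Y"
    unfolding mem_span_iff by (intro exI) (rule x)
  moreover have "0 \<le> c (x, real n) (v, 1)" if "v \<in> E" for v
    unfolding x c_combination_E[OF that] using u(1) that by simp
  ultimately show "(x, real n) \<in> span Y \<and> (\<forall>y\<in>Y. 0 \<le> c (x, real n) y)"
    by (auto simp: Y_def)
next
  assume *: "(x, real n) \<in> span Y \<and> (\<forall>y\<in>Y. 0 \<le> c (x, real n) y)"
  define u where "u v = c (x, real n) (v, 1)" for v
  have nonneg: "\<forall>v\<in>E. 0 \<le> u v"
    using * by (auto simp: u_def Y_def)
  have "(x, real n) = (\<Sum>v\<in>E. u v *\<^sub>R (v, 1))"
    using sum_c[of "(x, real n)"] * by (simp add: sum_Y u_def)
  then have x: "x = (\<Sum>v\<in>E. u v *\<^sub>R v)" and n: "real n = sum u E"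
    by (simp_all add: prod_eq_iff fst_sum snd_sum)
  show "x \<in> dilate n \<Delta>"
  \<comment> \<open>Height zero cannot be rescaled to height one: the only cone point there is zero,
    and it lies in the dilate because \<Delta> is nonempty.\<close>
  proof (cases "n = 0")
    case True
    then have "u v = 0" if "v \<in> E" for v
      using n nonneg that finite_E by (simp add: sum_nonneg_eq_0_iff)
    then have "x = 0"
      by (simp add: x)
    moreover have "\<Delta> \<noteq> {}"
      using E_nonempty by (simp add: \<Delta>_def)
    ultimately show ?thesis
      using True by (auto simp: dilate_def)
  next
    case False
    have "(\<Sum>v\<in>E. (u v / real n) *\<^sub>R v) \<in> \<Delta>"
      using nonneg n False unfolding \<Delta>_iff
      by (intro exI[of _ "\<lambda>v. u v / real n"]) (auto simp: sum_divide_distrib[symmetric])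
    moreover have "x = real n *\<^sub>R (\<Sum>v\<in>E. (u v / real n) *\<^sub>R v)"
      using False by (simp add: x scaleR_sum_right)
    ultimately show ?thesis
      by (auto simp: dilate_def)
  qed
qed

lemma dilate_Int_iff: "x \<in> dilate n \<Delta> \<inter> M \<longleftrightarrow> (x, real n) \<in> cone_pts {} n"
  by (auto simp: dilate_iff cone_pts_def H_def)

lemma card_dilate: "card (dilate n \<Delta> \<inter> M) = card (cone_pts {} n)"
proof -
  have "cone_pts {} n = (\<lambda>x. (x, real n)) ` (dilate n \<Delta> \<inter> M)"
    using dilate_Int_iff by (auto simp: image_iff cone_pts_def)
  moreover have "card ((\<lambda>x. (x, real n)) ` (dilate n \<Delta> \<inter> M)) = card (dilate n \<Delta> \<inter> M)"
    by (rule card_image) (simp add: inj_on_def)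
  ultimately show ?thesis
    by simp
qed

lemma aff_dim_\<Delta>: "aff_dim \<Delta> = int (card E) - 1"
  using aff_indep affine_independent_iff_card[of E] by (simp add: \<Delta>_def aff_dim_convex_hull)

lemma card_E_pos: "0 < card E"
  using finite_E E_nonempty by (simp add: card_gt_0_iff)

lemma nat_aff_dim: "nat (aff_dim \<Delta>) = card E - 1"
  by (simp add: aff_dim_\<Delta>)

text \<open>The exponent of \<open>1 - fps_X\<close> is \<open>card Y\<close>, so the factors are
  used up exactly when the bounds at all vertices are in force.\<close>

lemma h_star_series_eq: "h_star_series M \<Delta> = cone_series Y"
proof -
  have "ehrhart_series M \<Delta> = cone_series {}"
    by (simp add: ehrhart_series_def cone_series_def card_dilate)
  then show ?thesis
    using cone_series_eq[OF order.refl] card_E_pos by (simp add: h_star_series_def nat_aff_dim card_Y)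
qed

lemma h_star_vector_eq: "h_star_vector M \<Delta> = map (\<lambda>i. int (card (cone_pts Y i))) [0..<card E]"
  using card_E_pos by (simp add: h_star_vector_def h_star_series_eq cone_series_def nat_aff_dim)

end

section \<open>Prime volume\<close>

lemma unimodal_map:
  fixes h :: "nat \<Rightarrow> int"
  assumes k: "k < n" and up: "\<And>i. i < k \<Longrightarrow> h i \<le> h (Suc i)"
    and down: "\<And>i. k \<le> i \<Longrightarrow> Suc i < n \<Longrightarrow> h (Suc i) \<le> h i"
  shows "unimodal (map h [0..<n])"
proof -
  have "h i \<le> h j" if "i \<le> j" "j \<le> k" for i j
    using that
  proof (induction j rule: dec_induct)
    case (step j)
    then show ?case
      using up[of j] by simp
  qed simp
  then have "sorted_wrt (\<le>) (take (Suc k) (map h [0..<n]))"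
    using k by (auto simp: sorted_wrt_iff_nth_less take_map simp del: upt_Suc)
  moreover have "h j \<le> h i" if "k \<le> i" "i \<le> j" "j < n" for i j
    using that(2,3)
  proof (induction j rule: dec_induct)
    case (step j)
    then show ?case
      using down[of j] that(1) by simp
  qed simp
  then have "sorted_wrt (\<ge>) (drop k (map h [0..<n]))"
    by (auto simp: sorted_wrt_iff_nth_less drop_map)
  ultimately show ?thesis
    unfolding unimodal_def using k by (intro exI[of _ k]) simp
qed

section \<open>The fundamental parallelepiped as a finite group\<close>

context vertex_simplex
begin

definition Box :: "('a \<times> real) set" where
  "Box = {x \<in> H. \<forall>y\<in>Y. 0 \<le> c x y \<and> c x y < 1}"

lemma Box_height:
  assumes "x \<in> Box"
  obtains i where "i < card E" "x \<in> cone_pts Y i"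
proof -
  have x: "x \<in> H" "\<And>y. y \<in> Y \<Longrightarrow> 0 \<le> c x y" "\<And>y. y \<in> Y \<Longrightarrow> c x y < 1"
    using assms by (auto simp: Box_def)
  have ht: "snd x = (\<Sum>y\<in>Y. c x y)"
    using ht_eq_snd[OF H_span[OF x(1)]] by (simp add: ht_def)
  obtain k where k: "snd x = of_int k"
    using x(1) by (auto simp: H_def elim: Ints_cases)
  have "0 \<le> snd x"
    unfolding ht by (intro sum_nonneg x)
  moreover have "(\<Sum>y\<in>Y. c x y) < (\<Sum>y\<in>Y. 1)"
    using finite_Y E_nonempty x by (intro sum_strict_mono) (auto simp: Y_def)
  ultimately have "snd x = real (nat k)" "nat k < card E"
    using k by (auto simp: ht card_Y)
  then show ?thesis
    using that x by (auto simp: cone_pts_def)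
qed

lemma Box_eq: "Box = (\<Union>i<card E. cone_pts Y i)"
proof
  show "Box \<subseteq> (\<Union>i<card E. cone_pts Y i)"
    using Box_height by blast
qed (auto simp: Box_def cone_pts_def)

lemma finite_Box: "finite Box"
  unfolding Box_eq by (simp add: finite_cone)

lemma card_Box: "card Box = (\<Sum>i<card E. card (cone_pts Y i))"
  unfolding Box_eq by (rule card_UN_disjoint) (auto simp: finite_cone, auto simp: cone_pts_def)

text \<open>Reduction into the parallelepiped modulo the lattice of the lifted vertices;
  \<open>fr (x + x')\<close> is the addition of the quotient group on representatives.\<close>

definition fr :: "'a \<times> real \<Rightarrow> 'a \<times> real" where
  "fr x = x - (\<Sum>y\<in>Y. of_int \<lfloor>c x y\<rfloor> *\<^sub>R y)"

lemma fr_H: "x \<in> H \<Longrightarrow> fr x \<in> H"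
  unfolding fr_def
  by (rule H_diff, assumption)
    (rule add_subgroup_sum[OF add_subgroup_H], rule add_subgroup_int_scale[OF add_subgroup_H Y_H])

lemma c_fr:
  assumes "x \<in> H" "y \<in> Y"
  shows "c (fr x) y = frac (c x y)"
proof -
  have "(\<Sum>y\<in>Y. of_int \<lfloor>c x y\<rfloor> *\<^sub>R y) \<in> span Y"
    by (intro span_sum span_scale span_Y)
  then show ?thesis
    using assms by (simp add: fr_def c_diff H_span c_combination frac_def)
qed

lemma fr_Box: "x \<in> H \<Longrightarrow> fr x \<in> Box"
  by (simp add: Box_def fr_H c_fr frac_lt_1)

lemma Box_frac: "x \<in> Box \<Longrightarrow> y \<in> Y \<Longrightarrow> frac (c x y) = c x y"
  by (simp add: Box_def frac_eq)

lemma frac_frac_diff: "frac (frac (a + b) - b) = frac a" "frac (frac (a - b) + b) = frac a" for a b :: real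
proof -
  have "frac (a + b) - b - frac a = of_int (\<lfloor>a\<rfloor> - \<lfloor>a + b\<rfloor>)"
    "frac (a - b) + b - frac a = of_int (\<lfloor>a\<rfloor> - \<lfloor>a - b\<rfloor>)"
    by (simp_all add: frac_def)
  then have "frac (a + b) - b - frac a \<in> \<int>" "frac (a - b) + b - frac a \<in> \<int>"
    by (simp_all only: Ints_of_int)
  then show "frac (frac (a + b) - b) = frac a" "frac (frac (a - b) + b) = frac a"
    by (simp_all only: frac_unique_iff frac_ge_0 frac_lt_1 simp_thms)
qed

text \<open>Lagrange's theorem for the kernel of the homomorphism that takes the coordinate at
  \<open>y\<close> modulo 1: its fibres are cosets of the kernel.\<close>

lemma card_zero_fiber_dvd:
  assumes y: "y \<in> Y"
  shows "card {x \<in> Box. c x y = 0} dvd card Box"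
proof -
  have fiber: "card {x \<in> Box. c x y = c x0 y} = card {x \<in> Box. c x y = 0}" if x0: "x0 \<in> Box" for x0
  proof -
    have x0H: "x0 \<in> H"
      using x0 by (simp add: Box_def)
    have BH: "x \<in> Box \<Longrightarrow> x \<in> H" for x
      by (simp add: Box_def)
    have c1: "c (fr (x + x0)) y' = frac (c x y' + c x0 y')" and c2: "c (fr (x - x0)) y' = frac (c x y' - c x0 y')"
      if "x \<in> H" "y' \<in> Y" for x y'
      using that x0H by (simp_all add: c_fr H_add H_diff c_add c_diff H_span)
    have "bij_betw (\<lambda>x. fr (x + x0)) {x \<in> Box. c x y = 0} {x \<in> Box. c x y = c x0 y}"
    proof (rule bij_betw_byWitness[where f' = "\<lambda>x. fr (x - x0)"])
      show "\<forall>x\<in>{x \<in> Box. c x y = 0}. fr (fr (x + x0) - x0) = x"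
        using x0H by (auto intro!: eq_if_c_eq simp: c1 c2 BH fr_H H_add H_diff H_span frac_frac_diff Box_frac)
      show "\<forall>x\<in>{x \<in> Box. c x y = c x0 y}. fr (fr (x - x0) + x0) = x"
        using x0H by (auto intro!: eq_if_c_eq simp: c1 c2 BH fr_H H_add H_diff H_span frac_frac_diff Box_frac)
      show "(\<lambda>x. fr (x + x0)) ` {x \<in> Box. c x y = 0} \<subseteq> {x \<in> Box. c x y = c x0 y}"
        using x0H y x0 by (auto simp: c1 BH fr_Box H_add Box_frac)
      show "(\<lambda>x. fr (x - x0)) ` {x \<in> Box. c x y = c x0 y} \<subseteq> {x \<in> Box. c x y = 0}"
        using x0H y by (auto simp: c2 BH fr_Box H_diff)
    qed
    then show ?thesis
      by (rule bij_betw_same_card[symmetric])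
  qed
  have "card Box = (\<Sum>t\<in>(\<lambda>x. c x y) ` Box. \<Sum>x\<in>{x. x \<in> Box \<and> c x y = t}. 1)"
    unfolding card_eq_sum by (rule sum.image_gen[OF finite_Box])
  also have "\<dots> = (\<Sum>t\<in>(\<lambda>x. c x y) ` Box. card {x \<in> Box. c x y = 0})"
    using fiber by (intro sum.cong) auto
  finally show ?thesis
    by simp
qed

lemma cone_pts_Y_0: "cone_pts Y 0 = {0}"
proof
  show "cone_pts Y 0 \<subseteq> {0}"
  proof
    fix x
    assume x: "x \<in> cone_pts Y 0"
    then have "(\<Sum>y\<in>Y. c x y) = 0"
      using ht_eq_snd[of x] by (simp add: ht_def cone_pts_def H_span)
    then have "\<forall>y\<in>Y. c x y = 0"
      using x finite_Y by (subst (asm) sum_nonneg_eq_0_iff) (auto simp: cone_pts_def)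
    then show "x \<in> {0}"
      using x sum_c[of x] by (simp add: cone_pts_def H_span)
  qed
qed (simp add: cone_pts_def H_0 representation_zero)

section \<open>Prime order and the face on \<open>J\<close>\<close>

context
  assumes prime: "prime (card Box)" and IDP: "IDP M \<Delta>"
begin

text \<open>The simplex is an iterated pyramid over the face spanned by \<open>J\<close>; the remaining vertices do not
  contribute to the \<open>h\<^sup>*\<close>-vector.\<close>

definition J where "J = {y \<in> Y. \<exists>x\<in>Box. c x y \<noteq> 0}"

definition L where "L = {x \<in> H. \<forall>y\<in>Y - J. c x y = 0}"

lemma J_subset: "J \<subseteq> Y"
  by (auto simp: J_def)

lemma Box_0: "0 \<in> Box"
  by (simp add: Box_def H_0 representation_zero)

text \<open>For a vertex in \<open>J\<close> the kernel of the coordinate homomorphism is proper and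
  its order divides a prime; hence it is trivial.\<close>

lemma Box_eq_0:
  assumes x: "x \<in> Box" and y: "y \<in> J" and eq: "c x y = 0"
  shows "x = 0"
proof -
  have yY: "y \<in> Y"
    using y J_subset by blast
  have "{x \<in> Box. c x y = 0} \<noteq> Box"
    using y by (auto simp: J_def)
  then have "{x \<in> Box. c x y = 0} \<subset> Box"
    by blast
  then have "card {x \<in> Box. c x y = 0} \<noteq> card Box"
    by (intro less_imp_neq psubset_card_mono finite_Box)
  then have "card {x \<in> Box. c x y = 0} = 1"
    using prime card_zero_fiber_dvd[OF yY] unfolding prime_nat_iff by blast
  then obtain x1 where "{x \<in> Box. c x y = 0} = {x1}"
    by (rule card_1_singletonE)
  moreover have "0 \<in> {x \<in> Box. c x y = 0}"
    by (simp add: Box_0 representation_zero)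
  moreover have "x \<in> {x \<in> Box. c x y = 0}"
    using x eq by simp
  ultimately show ?thesis
    by (metis singletonD)
qed

lemma indep_J: "independent J"
  using indep J_subset by (rule independent_mono)

lemma L_span_J: "x \<in> L \<Longrightarrow> x \<in> span J"
proof -
  assume x: "x \<in> L"
  have "x = (\<Sum>y\<in>Y. c x y *\<^sub>R y)"
    using x sum_c[of x] by (simp add: L_def H_span)
  also have "\<dots> = (\<Sum>y\<in>J. c x y *\<^sub>R y)"
    using x J_subset finite_Y by (intro sum.mono_neutral_right) (auto simp: L_def)
  finally show "x \<in> span J"
    by (metis (no_types, lifting) span_base span_scale span_sum)
qed

lemma rep_J: "x \<in> L \<Longrightarrow> representation J x = c x"
  using representation_extend[OF indep L_span_J J_subset] by simp

lemma rep_J_sum: "x \<in> L \<Longrightarrow> (\<Sum>y\<in>J. representation J x y) = snd x"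
proof -
  assume x: "x \<in> L"
  have "(\<Sum>y\<in>J. representation J x y) = (\<Sum>y\<in>Y. c x y)"
    unfolding rep_J[OF x]
    using x J_subset finite_Y by (intro sum.mono_neutral_left) (auto simp: L_def)
  then show ?thesis
    using x ht_eq_snd[of x] by (simp add: ht_def L_def H_span)
qed

lemma finite_L_box: "finite {x \<in> L. \<forall>y\<in>J. 0 < representation J x y \<and> representation J x y < 1}"
proof (rule finite_subset[OF _ finite_Box])
  show "{x \<in> L. \<forall>y\<in>J. 0 < representation J x y \<and> representation J x y < 1} \<subseteq> Box"
  proof
    fix x
    assume x: "x \<in> {x \<in> L. \<forall>y\<in>J. 0 < representation J x y \<and> representation J x y < 1}"
    then have "0 \<le> c x y \<and> c x y < 1" if "y \<in> Y" for y
      using that rep_J[of x] by (cases "y \<in> J") (auto simp: L_def less_imp_le)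
    then show "x \<in> Box"
      using x by (auto simp: Box_def L_def)
  qed
qed

interpretation core: simplex_coordinates J L
proof
  show "finite J"
    using J_subset finite_Y by (rule finite_subset)
  show "J \<subseteq> L"
    using J_subset by (auto simp: L_def Y_H c_basis)
  show "L \<subseteq> span J"
    using L_span_J by blast
  show "x + x' \<in> L" "x - x' \<in> L" if "x \<in> L" "x' \<in> L" for x x'
    using that by (auto simp: L_def H_add H_diff c_add c_diff H_span)
  show "representation J x y' \<in> \<int>" if x: "x \<in> L" and "y \<in> J" "y' \<in> J" "representation J x y \<in> \<int>" for x y y'
  proof -
    have xH: "x \<in> H" and Y: "y \<in> Y" "y' \<in> Y"
      using x that J_subset by (auto simp: L_def)
    \<comment> \<open>An integral coordinate of \<open>x\<close> becomes zero after reduction; then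
      the whole reduction is zero, so all fractional parts vanish.\<close>
    have "c (fr x) y = 0"
      using that by (simp add: c_fr[OF xH Y(1)] rep_J)
    then have "fr x = 0"
      using Box_eq_0[OF fr_Box[OF xH] \<open>y \<in> J\<close>] by blast
    then have "frac (c x y') = 0"
      using c_fr[OF xH Y(2)] by (simp add: representation_zero)
    then show ?thesis
      using x by (simp add: rep_J)
  qed
qed (use indep_J finite_L_box in \<open>auto simp: L_def H_0 representation_zero\<close>)

text \<open>Height at least one rules out zero, and a nonzero point of \<open>Box\<close> has
  positive coordinates on all of \<open>J\<close> and zero coordinates outside.\<close>

lemma A_eq_cone_pts:
  assumes "1 \<le> k"
  shows "core.A k = cone_pts Y k"
proof (intro equalityI subsetI)
  fix x
  assume x: "x \<in> core.A k"
  then have xL: "x \<in> L"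
    by (simp add: core.A_def)
  have "0 < c x y \<and> c x y < 1" if "y \<in> J" for y
    using x that by (simp add: core.A_def rep_J[OF xL])
  moreover have "c x y = 0" if "y \<in> Y - J" for y
    using xL that by (simp add: L_def)
  ultimately have "0 \<le> c x y \<and> c x y < 1" if "y \<in> Y" for y
    using that by (cases "y \<in> J") (auto simp: less_imp_le)
  moreover have "snd x = real k"
    using x rep_J_sum[OF xL] by (simp add: core.A_def core.ht_def)
  ultimately show "x \<in> cone_pts Y k"
    using xL by (auto simp: cone_pts_def L_def)
next
  fix x
  assume x: "x \<in> cone_pts Y k"
  then have xB: "x \<in> Box"
    by (auto simp: cone_pts_def Box_def)
  have "c x y = 0" if "y \<in> Y - J" for y
    using that xB unfolding J_def by blast
  then have xL: "x \<in> L"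
    using x by (simp add: L_def cone_pts_def)
  have "x \<noteq> 0"
    using x assms by (auto simp: cone_pts_def)
  then have "c x y \<noteq> 0" if "y \<in> J" for y
    using Box_eq_0[OF xB that] by blast
  moreover have "0 \<le> c x y \<and> c x y < 1" if "y \<in> J" for y
    using that J_subset xB unfolding Box_def by blast
  ultimately have "0 < c x y \<and> c x y < 1" if "y \<in> J" for y
    using that by (simp add: less_le)
  then show "x \<in> core.A k"
    using x xL rep_J_sum[OF xL] by (simp add: core.A_def core.ht_def rep_J cone_pts_def)
qed

interpretation core: idp_simplex J L
proof
  fix k x
  assume k: "1 \<le> k" and x: "x \<in> core.A k"
  then have xc: "x \<in> cone_pts Y k"
    by (simp add: A_eq_cone_pts)
  then have "x \<in> cone_pts {} k" "x = (fst x, real k)"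
    by (auto simp: cone_pts_def prod_eq_iff)
  then have "fst x \<in> dilate k \<Delta> \<inter> M"
    using dilate_Int_iff by metis
  then obtain w where w: "\<forall>i\<in>{1..k}. w i \<in> \<Delta> \<inter> M" "fst x = (\<Sum>i=1..k. w i)"
    using IDP k unfolding IDP_def by blast
  define w' where "w' i = (w (Suc i), 1::real)" for i
  have "dilate 1 \<Delta> = \<Delta>"
    by (simp add: dilate_def)
  then have w'1: "w' i \<in> cone_pts {} 1" if "i < k" for i
    using dilate_Int_iff[of "w (Suc i)" 1] w(1) that by (simp add: w'_def)
  have x_eq: "x = (\<Sum>i<k. w' i)"
  proof -
    have "(\<Sum>i=1..k. w i) = (\<Sum>i<k. w (Suc i))"
      by (rule sum.reindex_bij_witness[of _ Suc "\<lambda>i. i - 1"]) auto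
    then show ?thesis
      using w(2) xc by (simp add: w'_def prod_eq_iff fst_sum snd_sum cone_pts_def)
  qed
  have "w' i \<in> cone_pts Y 1" if i: "i < k" for i
  proof -
    \<comment> \<open>Coordinates of the summands are nonnegative and add up to those of
      \<open>x\<close>, hence stay below one; in particular no vertex occurs.\<close>
    have "c (w' i) y < 1" if y: "y \<in> Y" for y
    proof -
      have "c (w' i) y \<le> (\<Sum>i<k. c (w' i) y)"
        using i y w'1 by (intro member_le_sum) (auto simp: cone_pts_def)
      also have "\<dots> = c x y"
        unfolding x_eq using w'1 by (subst c_sum) (auto simp: cone_pts_def H_span)
      also have "c x y < 1"
        using xc y by (simp add: cone_pts_def)
      finally show ?thesis .
    qed
    then show ?thesis
      using w'1[OF i] by (simp add: cone_pts_def)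
  qed
  then show "\<exists>w. (\<forall>i<k. w i \<in> core.A 1) \<and> x = (\<Sum>i<k. w i)"
    using x_eq A_eq_cone_pts[of 1] by blast
qed

text \<open>Symmetry under \<open>i \<mapsto> m - i\<close> and growth in the first half put the
  peak at \<open>m div 2\<close>; the entries from \<open>m\<close> on vanish.\<close>

lemma unimodal_h_star: "unimodal (h_star_vector M \<Delta>)"
proof -
  define h where "h i = card (cone_pts Y i)" for i
  define m where "m = card J"
  have h_A: "h i = card (core.A i)" if "1 \<le> i" for i
    using A_eq_cone_pts[OF that] by (simp add: h_def)
  obtain x where x: "x \<in> Box" "x \<noteq> 0"
  proof -
    have "2 \<le> card Box"
      using prime by (rule prime_ge_2_nat)
    then have "\<not> Box \<subseteq> {0}"
      using card_mono[of "{0}" Box] by auto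
    then show ?thesis
      using that by blast
  qed
  obtain k where k: "x \<in> cone_pts Y k"
    using x(1) by (rule Box_height)
  have k1: "1 \<le> k"
    using k x(2) cone_pts_Y_0 by (cases k) auto
  then have xA: "x \<in> core.A k"
    using k by (simp add: A_eq_cone_pts)
  have A_lt: "i < m" if "z \<in> core.A i" "1 \<le> i" for z i
  proof -
    have "J \<noteq> {}"
      using that core.A_D(5)[OF that(1)] by (auto simp: core.ht_def)
    then have "core.ht z < (\<Sum>y\<in>J. 1)"
      unfolding core.ht_def using core.A_D(4)[OF that(1)] core.finite_Y by (intro sum_strict_mono) auto
    then show ?thesis
      using core.A_D(5)[OF that(1)] by (simp add: m_def)
  qed
  have m2: "2 \<le> m"
    using A_lt[OF xA k1] k1 by simp
  have mE: "m \<le> card E"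
    using card_mono[OF finite_Y J_subset] by (simp add: m_def card_Y)
  have h_vanish: "h i = 0" if "m \<le> i" for i
  proof -
    have "1 \<le> i" "core.A i = {}"
      using A_lt[of _ i] that m2 by fastforce+
    then show ?thesis
      by (simp add: h_A)
  qed
  have sym: "h (m - i) = h i" if "1 \<le> i" "i < m" for i
    using core.card_A_complement[of i] that by (simp add: h_A m_def)
  have mono: "h i \<le> h (Suc i)" if "1 \<le> i" "2 * (i + 1) \<le> m" for i
    using core.card_A_mono[of i] that by (simp add: h_A m_def)
  have "h 0 = 1"
    by (simp add: h_def cone_pts_Y_0)
  \<comment> \<open>The first step is not covered by \<open>card_A_mono\<close>, because
    \<open>h 0\<close> counts the point zero. It needs a point of height 1, supplied by decomposing
    a nonzero point of \<open>Box\<close>.\<close>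
  moreover have "h 1 \<noteq> 0"
  proof -
    obtain w where "\<forall>i<k. w i \<in> core.A 1"
      using core.idp[OF k1 xA] by blast
    then have "w 0 \<in> core.A 1"
      using k1 by simp
    then show ?thesis
      using core.finite_A[of 1] by (auto simp: h_A card_eq_0_iff)
  qed
  ultimately have up: "h i \<le> h (Suc i)" if "i < m div 2" for i
    using mono[of i] that by (cases "i = 0") auto
  have down: "h (Suc i) \<le> h i" if "m div 2 \<le> i" for i
  proof (cases "Suc i < m")
    case True
    have i1: "1 \<le> i"
      using that m2 by linarith
    have eq: "h i = h (m - i)" "h (Suc i) = h (m - Suc i)"
      using sym[of i] sym[of "Suc i"] True i1 by auto
    show ?thesis
    proof (cases "2 * (m - i) \<le> m")
      case True
      then have "h (m - Suc i) \<le> h (Suc (m - Suc i))"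
        using \<open>Suc i < m\<close> by (intro mono) auto
      then show ?thesis
        using \<open>Suc i < m\<close> by (simp add: eq Suc_diff_Suc)
    next
      case False
      \<comment> \<open>This happens only for odd \<open>m\<close> at the middle, where the two
        entries are mirror images of each other.\<close>
      then have "m - i = Suc i"
        using that by linarith
      then show ?thesis
        using eq(1) by simp
    qed
  qed (simp add: h_vanish)
  have "unimodal (map (\<lambda>i. int (h i)) [0..<card E])"
    using m2 mE up down by (intro unimodal_map[of "m div 2"]) auto
  then show ?thesis
    by (simp add: h_star_vector_eq h_def)
qed

end

end

section \<open>Normalized volume\<close>

definition psum :: "(nat \<Rightarrow> nat) \<Rightarrow> nat \<Rightarrow> nat" where
  "psum f n = (\<Sum>i\<le>n. f i)"

text \<open>Discrete forms of the derivative of x^(j+1); summing them replaces the integration of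
  x^j.\<close>

lemma power_Suc_bounds:
  fixes x :: nat
  shows "x ^ Suc j + Suc j * x ^ j \<le> Suc x ^ Suc j"
    and "Suc x ^ Suc j \<le> x ^ Suc j + Suc j * Suc x ^ j"
proof -
  show "x ^ Suc j + Suc j * x ^ j \<le> Suc x ^ Suc j"
  proof (induction j)
    case (Suc j)
    have "x ^ Suc (Suc j) + Suc (Suc j) * x ^ Suc j \<le> Suc x * (x ^ Suc j + Suc j * x ^ j)"
      by (simp add: algebra_simps)
    also have "\<dots> \<le> Suc x * Suc x ^ Suc j"
      by (intro mult_left_mono Suc) simp
    finally show ?case
      by simp
  qed simp
  show "Suc x ^ Suc j \<le> x ^ Suc j + Suc j * Suc x ^ j"
  proof (induction j)
    case (Suc j)
    have "Suc x ^ Suc (Suc j) = x * Suc x ^ Suc j + Suc x ^ Suc j"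
      by simp
    also have "\<dots> \<le> x * (x ^ Suc j + Suc j * Suc x ^ j) + Suc x ^ Suc j"
      by (intro add_right_mono mult_left_mono Suc) simp
    also have "\<dots> \<le> x ^ Suc (Suc j) + Suc (Suc j) * Suc x ^ Suc j"
      by (simp add: algebra_simps)
    finally show ?case .
  qed simp
qed

lemma sum_power_upper: "(\<Sum>i\<le>n. Suc j * (i + j) ^ j) \<le> (n + Suc j) ^ Suc j"
proof (induction n)
  case 0
  have "Suc j * j ^ j \<le> Suc j * Suc j ^ j"
    by (intro mult_left_mono power_mono) auto
  then show ?case
    by simp
next
  case (Suc n)
  then show ?case
    using power_Suc_bounds(1)[of "n + Suc j" j] by simp
qed

lemma sum_power_lower: "n ^ Suc j \<le> (\<Sum>i\<le>n. Suc j * i ^ j)"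
proof (induction n)
  case (Suc n)
  then show ?case
    using power_Suc_bounds(2)[of n j] by simp
qed simp

lemma iterated_psum_Suc: "(psum ^^ Suc (Suc j)) f n = (\<Sum>i\<le>n. (psum ^^ Suc j) f i)"
  by (simp only: funpow.simps(2)[of "Suc j"] o_apply psum_def)

text \<open>Each further summation integrates once, which accounts for the factorial; the shift by
  \<open>j\<close> inside the power absorbs the lower order terms.\<close>

lemma iterated_psum_upper:
  assumes "\<And>n. psum f n \<le> p"
  shows "fact j * (psum ^^ Suc j) f n \<le> p * (n + j) ^ j"
proof (induction j arbitrary: n)
  case 0
  then show ?case
    using assms by simp
next
  case (Suc j)
  have "fact (Suc j) * (psum ^^ Suc (Suc j)) f n = (\<Sum>i\<le>n. Suc j * (fact j * (psum ^^ Suc j) f i))"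
    by (simp only: iterated_psum_Suc fact_Suc of_nat_id sum_distrib_left mult.assoc)
  also have "\<dots> \<le> (\<Sum>i\<le>n. Suc j * (p * (i + j) ^ j))"
    by (intro sum_mono mult_left_mono Suc) simp
  also have "\<dots> = p * (\<Sum>i\<le>n. Suc j * (i + j) ^ j)"
    by (simp add: sum_distrib_left algebra_simps)
  also have "\<dots> \<le> p * (n + Suc j) ^ Suc j"
    by (intro mult_left_mono sum_power_upper) simp
  finally show ?case .
qed

text \<open>The matching lower bound; \<open>D\<close> is an index from which on the partial sums
  have reached \<open>p\<close>.\<close>

lemma iterated_psum_lower:
  assumes "\<And>n. D \<le> n \<Longrightarrow> p \<le> psum f n"
  shows "p * n ^ j \<le> fact j * (psum ^^ Suc j) f (n + D)"
proof (induction j arbitrary: n)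
  case 0
  then show ?case
    using assms by simp
next
  case (Suc j)
  have "p * n ^ Suc j \<le> p * (\<Sum>i\<le>n. Suc j * i ^ j)"
    by (intro mult_left_mono sum_power_lower) simp
  also have "\<dots> = (\<Sum>i\<le>n. Suc j * (p * i ^ j))"
    by (simp add: sum_distrib_left algebra_simps)
  also have "\<dots> \<le> (\<Sum>i\<le>n. Suc j * (fact j * (psum ^^ Suc j) f (i + D)))"
    by (intro sum_mono mult_left_mono Suc) simp
  also have "\<dots> = (\<Sum>i\<in>(\<lambda>i. i + D) ` {..n}. Suc j * (fact j * (psum ^^ Suc j) f i))"
    by (subst sum.reindex) (auto simp: inj_on_def)
  also have "\<dots> \<le> (\<Sum>i\<le>n + D. Suc j * (fact j * (psum ^^ Suc j) f i))"
    by (intro sum_mono2) auto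
  also have "\<dots> = fact (Suc j) * (psum ^^ Suc (Suc j)) f (n + D)"
    by (simp only: iterated_psum_Suc fact_Suc of_nat_id sum_distrib_left mult.assoc)
  finally show ?case .
qed

context vertex_simplex
begin

text \<open>Dropping the bound at one vertex divides the series by 1 - t, which is one
  summation.\<close>

lemma card_cone_eq_psum:
  assumes "y \<in> Y" "y \<notin> Z" "Z \<subseteq> Y"
  shows "card (cone_pts Z n) = psum (\<lambda>i. card (cone_pts (insert y Z) i)) n"
  by (induction n) (simp_all add: psum_def card_cone_Suc[OF assms] cone_insert_0[OF assms(1)])

lemma card_cone_iterated:
  "Z \<subseteq> Y \<Longrightarrow> card (Y - Z) = k \<Longrightarrow> (\<lambda>n. card (cone_pts Z n)) = (psum ^^ k) (\<lambda>n. card (cone_pts Y n))"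
proof (induction k arbitrary: Z)
  case 0
  then have "Z = Y"
    using finite_Y by auto
  then show ?case
    by simp
next
  case (Suc k)
  then obtain y where y: "y \<in> Y" "y \<notin> Z"
    by (metis Diff_eq_empty_iff card.empty nat.distinct(1) subsetI)
  have eq: "Y - Z = insert y (Y - insert y Z)"
    using y by auto
  have "card (Y - Z) = Suc (card (Y - insert y Z))"
    by (subst eq) (rule card_insert_disjoint, use finite_Y in auto)
  then have "card (Y - insert y Z) = k"
    using Suc.prems(2) by linarith
  then have "(\<lambda>n. card (cone_pts (insert y Z) n)) = (psum ^^ k) (\<lambda>n. card (cone_pts Y n))"
    using Suc.IH[of "insert y Z"] Suc.prems(1) y by simp
  then show ?case
    using card_cone_eq_psum[OF y Suc.prems(1)] by (simp add: fun_eq_iff)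
qed

lemma psum_cone_Y:
  fixes n
  defines "p \<equiv> (\<Sum>i<card E. card (cone_pts Y i))"
  shows "psum (\<lambda>i. card (cone_pts Y i)) n \<le> p" and "card E \<le> n \<Longrightarrow> p \<le> psum (\<lambda>i. card (cone_pts Y i)) n"
proof -
  have vanish: "card (cone_pts Y i) = 0" if "card E \<le> i" for i
  proof -
    have "x \<notin> cone_pts Y i" for x
    proof
      assume x: "x \<in> cone_pts Y i"
      then have "snd x = (\<Sum>y\<in>Y. c x y)"
        using ht_eq_snd[of x] by (simp add: ht_def cone_pts_def H_span)
      also have "\<dots> < (\<Sum>y\<in>Y. 1)"
        using x finite_Y E_nonempty by (intro sum_strict_mono) (auto simp: cone_pts_def Y_def)
      finally show False
        using that x by (simp add: card_Y cone_pts_def)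
    qed
    then show ?thesis
      by (metis card.empty equals0I)
  qed
  have "psum (\<lambda>i. card (cone_pts Y i)) n = (\<Sum>i\<in>{..n} \<inter> {..<card E}. card (cone_pts Y i))"
    unfolding psum_def by (rule sum.mono_neutral_right) (simp, blast, intro ballI vanish, auto)
  also have "\<dots> \<le> p"
    unfolding p_def by (intro sum_mono2) auto
  finally show "psum (\<lambda>i. card (cone_pts Y i)) n \<le> p" .
  show "p \<le> psum (\<lambda>i. card (cone_pts Y i)) n" if "card E \<le> n"
    unfolding psum_def p_def using that by (intro sum_mono2) auto
qed

text \<open>Together the bounds identify \<open>p / fact d\<close> as the leading coefficient of the
  count of lattice points in dilates.\<close>

lemma card_dilate_bounds:
  defines "p \<equiv> (\<Sum>i<card E. card (cone_pts Y i))" and "d \<equiv> card E - 1"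
  shows "p * n ^ d \<le> fact d * card (cone_pts {} (n + card E))"
    and "fact d * card (cone_pts {} n) \<le> p * (n + d) ^ d"
proof -
  have "card (Y - {}) = Suc d"
    using card_E_pos by (simp add: card_Y d_def)
  from card_cone_iterated[OF empty_subsetI this]
  have eq: "card (cone_pts {} n) = (psum ^^ Suc d) (\<lambda>n. card (cone_pts Y n)) n" for n
    by (rule fun_cong)
  show "p * n ^ d \<le> fact d * card (cone_pts {} (n + card E))"
    unfolding eq p_def by (rule iterated_psum_lower) (rule psum_cone_Y)
  show "fact d * card (cone_pts {} n) \<le> p * (n + d) ^ d"
    unfolding eq p_def by (rule iterated_psum_upper) (rule psum_cone_Y)
qed

end

section \<open>Volume of the simplex by counting small cubes\<close>

locale simplex_volume = vertex_simplex M E B\<^sub>0 for M E B\<^sub>0 :: "'a::euclidean_space set" +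
  fixes v :: 'a and B :: "'a set"
  assumes v: "v \<in> \<Delta>" "v \<in> M" and B: "lattice_basis B (sublattice_at M \<Delta> v)"
begin

definition \<phi> :: "('a \<Rightarrow> real) \<Rightarrow> 'a" where "\<phi> x = (\<Sum>b\<in>B. x b *\<^sub>R b)"

lemma finite_B: "finite B" and indep_B: "independent B"
  using B by (auto simp: lattice_basis_def)

lemma sublattice_iff: "w \<in> sublattice_at M \<Delta> v \<longleftrightarrow> (\<exists>z :: 'a \<Rightarrow> int. w = \<phi> (\<lambda>b. of_int (z b)))"
  unfolding \<phi>_def by (rule lattice_mem_iff[OF B])

lemma \<phi>_add: "\<phi> (\<lambda>b. x b + x' b) = \<phi> x + \<phi> x'"
  by (simp add: \<phi>_def scaleR_add_left sum.distrib)

lemma \<phi>_scale: "\<phi> (\<lambda>b. r * x b) = r *\<^sub>R \<phi> x"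
  by (simp add: \<phi>_def scaleR_sum_right)

lemma \<phi>_cong: "(\<And>b. b \<in> B \<Longrightarrow> x b = x' b) \<Longrightarrow> \<phi> x = \<phi> x'"
  by (simp add: \<phi>_def)

lemma \<phi>_inj:
  assumes "\<phi> x = \<phi> x'" "b \<in> B"
  shows "x b = x' b"
proof (rule ccontr)
  assume "x b \<noteq> x' b"
  moreover have "(\<Sum>b\<in>B. (x b - x' b) *\<^sub>R b) = 0"
    using assms(1) by (simp add: \<phi>_def scaleR_diff_left sum_subtractf)
  ultimately have "dependent B"
    using assms(2) by (subst dependent_finite[OF finite_B]) (auto intro!: exI[of _ "\<lambda>b. x b - x' b"])
  then show False
    using indep_B by blast
qed

abbreviation dir :: "'a set" where "dir \<equiv> span ((\<lambda>x. x - v) ` \<Delta>)"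

lemma E_subset_\<Delta>: "E \<subseteq> \<Delta>"
  by (simp add: \<Delta>_def hull_subset)

lemma vertex_diff: "u \<in> E \<Longrightarrow> u - v \<in> sublattice_at M \<Delta> v"
  using E_subset E_subset_\<Delta> v lattice_diff[OF lattice] by (auto simp: sublattice_at_def intro!: span_base)

lemma B_subset: "B \<subseteq> sublattice_at M \<Delta> v"
proof
  fix b
  assume "b \<in> B"
  then have "b = \<phi> (\<lambda>b'. of_int (if b' = b then 1 else 0))"
    using finite_B by (simp add: \<phi>_def if_distrib if_distribR cong: if_cong)
  then show "b \<in> sublattice_at M \<Delta> v"
    unfolding sublattice_iff by (intro exI[of _ "\<lambda>b'. if b' = b then 1 else 0"])
qed

lemma span_B: "span B = dir"
proof
  show "span B \<subseteq> dir"
    using B_subset by (intro span_minimal) (auto simp: sublattice_at_def)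
  have "x - v \<in> span B" if x: "x \<in> \<Delta>" for x
  proof -
    obtain u where u: "sum u E = 1" "(\<Sum>e\<in>E. u e *\<^sub>R e) = x"
      using x unfolding \<Delta>_iff by blast
    have "x - v = (\<Sum>e\<in>E. u e *\<^sub>R (e - v))"
      using u by (simp add: scaleR_diff_right sum_subtractf scaleR_sum_left[symmetric])
    moreover have "e - v \<in> span B" if e: "e \<in> E" for e
    proof -
      obtain z :: "'a \<Rightarrow> int" where "e - v = \<phi> (\<lambda>b. of_int (z b))"
        using vertex_diff[OF e] unfolding sublattice_iff by blast
      then show ?thesis
        unfolding \<phi>_def by (simp only: span_sum span_scale span_base)
    qed
    ultimately show ?thesis
      by (simp add: span_sum span_scale)
  qed
  then show "dir \<subseteq> span B"
    by (intro span_minimal) auto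
qed

lemma card_B: "card B = card E - 1"
proof -
  have "aff_dim \<Delta> = int (dim ((\<lambda>x. x - v) ` \<Delta>))"
    by (rule aff_dim_eq_dim_subtract) (rule hull_inc[OF v(1)])
  also have "dim ((\<lambda>x. x - v) ` \<Delta>) = card B"
    by (rule dim_eq_card[OF span_B indep_B])
  finally show ?thesis
    by (simp add: aff_dim_\<Delta>)
qed

definition inD :: "nat \<Rightarrow> 'a \<Rightarrow> bool" where "inD n w \<longleftrightarrow> w + real n *\<^sub>R v \<in> dilate n \<Delta>"

lemma inD_add:
  assumes "inD n w" "inD m w'"
  shows "inD (n + m) (w + w')"
proof -
  have "(w + w' + real (n + m) *\<^sub>R v, real (n + m)) = (w + real n *\<^sub>R v, real n) + (w' + real m *\<^sub>R v, real m)"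
    by (simp add: scaleR_add_left)
  then show ?thesis
    using assms unfolding inD_def dilate_iff
    by (simp only: c_add span_add simp_thms) auto
qed

lemma inD_scale: "1 \<le> n \<Longrightarrow> inD n (real n *\<^sub>R w) \<longleftrightarrow> w + v \<in> \<Delta>"
proof -
  assume n: "1 \<le> n"
  have "real n *\<^sub>R w + real n *\<^sub>R v = real n *\<^sub>R (w + v)"
    by (simp add: scaleR_add_right)
  then show ?thesis
    unfolding inD_def dilate_def using n by (auto simp: image_iff)
qed

lemma dir_lift: "w \<in> dir \<Longrightarrow> (w, 0) \<in> span Y"
proof -
  assume w: "w \<in> dir"
  have "subspace {w. (w, 0::real) \<in> span Y}"
  proof (rule subspaceI)
    show "0 \<in> {w. (w, 0::real) \<in> span Y}"
      using span_zero[of Y] by (simp add: zero_prod_def)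
    show "x + y \<in> {w. (w, 0::real) \<in> span Y}"
      if "x \<in> {w. (w, 0::real) \<in> span Y}" "y \<in> {w. (w, 0::real) \<in> span Y}" for x y
      using that span_add[of "(x, 0)" Y "(y, 0)"] by simp
    show "r *\<^sub>R x \<in> {w. (w, 0::real) \<in> span Y}" if "x \<in> {w. (w, 0::real) \<in> span Y}" for r x
      using that span_scale[of "(x, 0)" Y r] by simp
  qed
  moreover have "(x - v, 0) \<in> span Y" if "x \<in> \<Delta>" for x
  proof -
    have "dilate 1 \<Delta> = \<Delta>"
      by (simp add: dilate_def)
    then have "(x, 1) \<in> span Y" "(v, 1) \<in> span Y"
      using that v dilate_iff[of _ 1] by auto
    from span_diff[OF this] show ?thesis
      by simp
  qed
  ultimately have "dir \<subseteq> {w. (w, 0) \<in> span Y}"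
    by (intro span_minimal) auto
  then show ?thesis
    using w by blast
qed

definition grid :: "nat \<Rightarrow> ('a \<Rightarrow> int) set" where
  "grid n = {z \<in> B \<rightarrow>\<^sub>E UNIV. inD n (\<phi> (\<lambda>b. of_int (z b)))}"

lemma bij_grid: "bij_betw (\<lambda>z. \<phi> (\<lambda>b. of_int (z b)) + real n *\<^sub>R v) (grid n) (dilate n \<Delta> \<inter> M)"
  unfolding bij_betw_def
proof
  show "inj_on (\<lambda>z. \<phi> (\<lambda>b. of_int (z b)) + real n *\<^sub>R v) (grid n)"
  proof (rule inj_onI)
    fix z z'
    assume z: "z \<in> grid n" "z' \<in> grid n"
      and eq: "\<phi> (\<lambda>b. of_int (z b)) + real n *\<^sub>R v = \<phi> (\<lambda>b. of_int (z' b)) + real n *\<^sub>R v"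
    then have "z b = z' b" if "b \<in> B" for b
      using \<phi>_inj[of "\<lambda>b. of_int (z b)" "\<lambda>b. of_int (z' b)"] that by simp
    then show "z = z'"
      using z by (intro PiE_ext[of z B "\<lambda>_. UNIV"]) (auto simp: grid_def)
  qed
  have nv: "real n *\<^sub>R v \<in> M"
    by (rule add_subgroup_nat_scale[OF add_subgroup_lattice[OF lattice] v(2)])
  show "(\<lambda>z. \<phi> (\<lambda>b. of_int (z b)) + real n *\<^sub>R v) ` grid n = dilate n \<Delta> \<inter> M"
  proof (intro equalityI subsetI)
    fix x
    assume "x \<in> (\<lambda>z. \<phi> (\<lambda>b. of_int (z b)) + real n *\<^sub>R v) ` grid n"
    then obtain z where z: "x = \<phi> (\<lambda>b. of_int (z b)) + real n *\<^sub>R v" "x \<in> dilate n \<Delta>"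
      by (auto simp: grid_def inD_def)
    moreover have "\<phi> (\<lambda>b. of_int (z b)) \<in> M"
      using sublattice_iff by (auto simp: sublattice_at_def)
    ultimately show "x \<in> dilate n \<Delta> \<inter> M"
      using lattice_add[OF lattice _ nv] by simp
  next
    fix x
    assume x: "x \<in> dilate n \<Delta> \<inter> M"
    then obtain x' where x': "x = real n *\<^sub>R x'" "x' \<in> \<Delta>"
      by (auto simp: dilate_def)
    have "x - real n *\<^sub>R v = real n *\<^sub>R (x' - v)"
      by (simp add: x' scaleR_diff_right)
    also have "\<dots> \<in> dir"
      using x' by (intro span_scale span_base) auto
    finally have "x - real n *\<^sub>R v \<in> sublattice_at M \<Delta> v"
      using x lattice_diff[OF lattice _ nv] by (simp add: sublattice_at_def)
    then obtain z :: "'a \<Rightarrow> int" where z: "x - real n *\<^sub>R v = \<phi> (\<lambda>b. of_int (z b))"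
      unfolding sublattice_iff by blast
    have rz: "\<phi> (\<lambda>b. of_int (restrict z B b)) = \<phi> (\<lambda>b. of_int (z b))"
      by (rule \<phi>_cong) simp
    have "x = \<phi> (\<lambda>b. of_int (restrict z B b)) + real n *\<^sub>R v"
      unfolding rz z[symmetric] by simp
    moreover have "restrict z B \<in> grid n"
      unfolding grid_def inD_def using calculation x by auto
    ultimately show "x \<in> (\<lambda>z. \<phi> (\<lambda>b. of_int (z b)) + real n *\<^sub>R v) ` grid n"
      by blast
  qed
qed

lemma card_grid: "card (grid n) = card (cone_pts {} n)"
  using bij_betw_same_card[OF bij_grid] by (simp add: card_dilate)

lemma finite_grid: "finite (grid n)"
proof -
  have "finite (cone_pts {} n)"
    by (rule finite_cone)
  then have "finite (fst ` cone_pts {} n)"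
    by (rule finite_imageI)
  moreover have "dilate n \<Delta> \<inter> M \<subseteq> fst ` cone_pts {} n"
    using dilate_Int_iff by (force simp: image_iff)
  ultimately have "finite (dilate n \<Delta> \<inter> M)"
    by (rule rev_finite_subset)
  then show ?thesis
    using bij_betw_finite[OF bij_grid] by simp
qed

text \<open>A lattice point so deep inside a dilate that the surrounding cubes stay inside: adding it to the
  corners of small cubes absorbs all boundary effects in \<open>volume_sandwich\<close>.\<close>

lemma interior_shift:
  obtains e :: "'a \<Rightarrow> int" and s :: nat
  where "1 \<le> s" "\<And>x. (\<And>b. b \<in> B \<Longrightarrow> \<bar>x b\<bar> \<le> 1) \<Longrightarrow> inD s (\<phi> (\<lambda>b. of_int (e b)) + \<phi> x)"
proof -
  \<comment> \<open>\<open>K\<close> bounds all vertex coordinates of \<open>\<phi> x\<close> when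
    \<open>\<bar>x b\<bar> \<le> 1\<close>; a point whose vertex coordinates all equal
    \<open>N\<close> therefore absorbs such a vector, and its height is
    \<open>N * card E\<close>.\<close>
  define K where "K = (\<Sum>y\<in>Y. \<Sum>b\<in>B. \<bar>c (b, 0) y\<bar>)"
  obtain N :: nat where N: "K \<le> real N" "1 \<le> N"
    using real_arch_simple[of "max K 1"] by (metis max.bounded_iff of_nat_1 of_nat_le_iff)
  define s where "s = N * card E"
  have "(\<Sum>u\<in>E. real N *\<^sub>R (u - v)) \<in> sublattice_at M \<Delta> v"
    by (intro add_subgroup_sum[OF add_subgroup_lattice[OF B]] add_subgroup_nat_scale[OF add_subgroup_lattice[OF B]] vertex_diff)
  then obtain e :: "'a \<Rightarrow> int" where e: "(\<Sum>u\<in>E. real N *\<^sub>R (u - v)) = \<phi> (\<lambda>b. of_int (e b))"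
    unfolding sublattice_iff by blast
  have "inD s (\<phi> (\<lambda>b. of_int (e b)) + \<phi> x)" if x: "\<And>b. b \<in> B \<Longrightarrow> \<bar>x b\<bar> \<le> 1" for x
  proof -
    have \<phi>_dir: "\<phi> x \<in> dir"
      unfolding \<phi>_def span_B[symmetric] by (intro span_sum span_scale span_base)
    have NY: "(\<Sum>y\<in>Y. real N *\<^sub>R y) \<in> span Y"
      by (intro span_sum span_scale span_Y)
    have "\<phi> (\<lambda>b. of_int (e b)) + real s *\<^sub>R v = (\<Sum>u\<in>E. real N *\<^sub>R u)"
      unfolding e[symmetric] by (simp add: s_def scaleR_diff_right sum_subtractf sum_constant_scaleR mult.commute)
    then have eq: "(\<phi> (\<lambda>b. of_int (e b)) + \<phi> x + real s *\<^sub>R v, real s) = (\<Sum>y\<in>Y. real N *\<^sub>R y) + (\<phi> x, 0)"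
      by (simp add: sum_Y prod_eq_iff fst_sum snd_sum s_def algebra_simps)
    have "0 \<le> c ((\<Sum>y\<in>Y. real N *\<^sub>R y) + (\<phi> x, 0)) y" if y: "y \<in> Y" for y
    proof -
      have lift0: "(b, 0) \<in> span Y" if "b \<in> B" for b
        using that span_base[of b B] dir_lift[of b] span_B by simp
      have lift: "x b *\<^sub>R (b, 0) \<in> span Y" if "b \<in> B" for b
        by (rule span_scale) (rule lift0[OF that])
      have "(\<phi> x, 0) = (\<Sum>b\<in>B. x b *\<^sub>R (b, 0::real))"
        by (simp add: \<phi>_def prod_eq_iff fst_sum snd_sum)
      then have "c (\<phi> x, 0) y = (\<Sum>b\<in>B. c (x b *\<^sub>R (b, 0)) y)"
        using c_sum[of B "\<lambda>b. x b *\<^sub>R (b, 0)" y] lift by simp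
      also have "\<dots> = (\<Sum>b\<in>B. x b * c (b, 0) y)"
        by (intro sum.cong refl c_scale lift0)
      finally have "\<bar>c (\<phi> x, 0) y\<bar> \<le> (\<Sum>b\<in>B. \<bar>x b * c (b, 0) y\<bar>)"
        by simp
      also have "\<dots> \<le> (\<Sum>b\<in>B. \<bar>c (b, 0) y\<bar>)"
        using x by (intro sum_mono) (simp add: abs_mult mult_left_le_one_le)
      also have "\<dots> \<le> K"
        unfolding K_def using y finite_Y by (intro member_le_sum) (auto intro: sum_nonneg)
      finally have "- real N \<le> c (\<phi> x, 0) y"
        using N by linarith
      then show ?thesis
        using y by (simp add: c_add[OF NY dir_lift[OF \<phi>_dir]] c_combination)
    qed
    then show ?thesis
      unfolding inD_def dilate_iff eq using span_add[OF NY dir_lift[OF \<phi>_dir]] by simp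
  qed
  moreover have "1 \<le> s"
    using N card_E_pos by (simp add: s_def Suc_le_eq)
  ultimately show ?thesis
    using that by blast
qed

abbreviation \<mu> where "\<mu> \<equiv> Pi\<^sub>M B (\<lambda>_. lborel :: real measure)"

definition K :: "('a \<Rightarrow> real) set" where
  "K = {x \<in> B \<rightarrow>\<^sub>E UNIV. (\<Sum>b\<in>B. x b *\<^sub>R b) \<in> (\<lambda>y. y - v) ` \<Delta>}"

lemma K_iff: "1 \<le> n \<Longrightarrow> x \<in> K \<longleftrightarrow> x \<in> B \<rightarrow>\<^sub>E UNIV \<and> inD n (\<phi> (\<lambda>b. real n * x b))"
proof -
  have "w \<in> (\<lambda>y. y - v) ` \<Delta> \<longleftrightarrow> w + v \<in> \<Delta>" for w
    by (auto simp: image_iff) (metis add_diff_cancel_right')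
  then show "1 \<le> n \<Longrightarrow> x \<in> K \<longleftrightarrow> x \<in> B \<rightarrow>\<^sub>E UNIV \<and> inD n (\<phi> (\<lambda>b. real n * x b))"
    unfolding K_def \<phi>_scale by (simp add: inD_scale \<phi>_def)
qed

lemma K_sets: "K \<in> sets \<mu>"
proof -
  have "closed ((\<lambda>y. y - v) ` \<Delta>)"
  proof (rule compact_imp_closed)
    show "compact ((\<lambda>y. y - v) ` \<Delta>)"
      unfolding \<Delta>_def by (intro compact_continuous_image continuous_intros finite_imp_compact_convex_hull finite_E)
  qed
  then have "(\<lambda>x. \<Sum>b\<in>B. x b *\<^sub>R b) -` ((\<lambda>y. y - v) ` \<Delta>) \<inter> space \<mu> \<in> sets \<mu>"
    by (intro measurable_sets[of _ _ borel] borel_closed borel_measurable_sum borel_measurable_scaleR) measurable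
  also have "(\<lambda>x. \<Sum>b\<in>B. x b *\<^sub>R b) -` ((\<lambda>y. y - v) ` \<Delta>) \<inter> space \<mu> = K"
    by (auto simp: K_def space_PiM)
  finally show ?thesis .
qed

definition cube :: "nat \<Rightarrow> ('a \<Rightarrow> int) \<Rightarrow> ('a \<Rightarrow> real) set" where
  "cube n z = Pi\<^sub>E B (\<lambda>b. {real_of_int (z b) / real n..<(real_of_int (z b) + 1) / real n})"

lemma cube_sets: "cube n z \<in> sets \<mu>"
  unfolding cube_def by (intro sets_PiM_I_finite finite_B) simp

lemma emeasure_cube: "1 \<le> n \<Longrightarrow> emeasure \<mu> (cube n z) = ennreal ((1 / real n) ^ card B)"
proof -
  assume n: "1 \<le> n"
  interpret product_sigma_finite "\<lambda>_ :: 'a. lborel :: real measure" ..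
  have "emeasure \<mu> (cube n z) = (\<Prod>b\<in>B. emeasure lborel {real_of_int (z b) / real n..<(real_of_int (z b) + 1) / real n})"
    unfolding cube_def by (rule emeasure_PiM[OF finite_B]) simp
  also have "\<dots> = (\<Prod>b\<in>B. ennreal (1 / real n))"
    using n by (intro prod.cong refl) (simp add: emeasure_lborel_Ico divide_right_mono diff_divide_distrib[symmetric])
  finally show ?thesis
    by (simp add: ennreal_power)
qed

lemma mem_cube_iff:
  "1 \<le> n \<Longrightarrow> x \<in> cube n z \<longleftrightarrow> x \<in> B \<rightarrow>\<^sub>E UNIV \<and> (\<forall>b\<in>B. z b = \<lfloor>real n * x b\<rfloor>)"
proof -
  assume "1 \<le> n"
  then have "real_of_int (z b) / real n \<le> t \<and> t < (real_of_int (z b) + 1) / real n \<longleftrightarrow> z b = \<lfloor>real n * t\<rfloor>" for b t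
    by (auto simp: field_simps floor_eq_iff eq_commute[of "z b"])
  then show "x \<in> cube n z \<longleftrightarrow> x \<in> B \<rightarrow>\<^sub>E UNIV \<and> (\<forall>b\<in>B. z b = \<lfloor>real n * x b\<rfloor>)"
    unfolding cube_def by (auto simp: PiE_iff)
qed

text \<open>For the lower bound, disjoint cubes of side 1/(n+s) at shifted grid points of level
  \<open>n\<close> fit into \<open>K\<close>; for the upper bound, cubes of side 1/n at shifted grid
  points of level \<open>n + s\<close> cover it.\<close>

lemma volume_sandwich:
  obtains s :: nat where "1 \<le> s"
    "\<And>n. real (card (cone_pts {} n)) * (1 / real (n + s)) ^ card B \<le> measure \<mu> K"
    "\<And>n. 1 \<le> n \<Longrightarrow> measure \<mu> K \<le> real (card (cone_pts {} (n + s))) * (1 / real n) ^ card B"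
proof -
  obtain e :: "'a \<Rightarrow> int" and s :: nat where s: "1 \<le> s"
    and e: "\<And>x. (\<And>b. b \<in> B \<Longrightarrow> \<bar>x b\<bar> \<le> 1) \<Longrightarrow> inD s (\<phi> (\<lambda>b. of_int (e b)) + \<phi> x)"
    using interior_shift by metis
  have lower: "(\<Union>z\<in>grid n. cube (n + s) (\<lambda>b. z b + e b)) \<subseteq> K" for n
  proof
    fix x
    assume "x \<in> (\<Union>z\<in>grid n. cube (n + s) (\<lambda>b. z b + e b))"
    then obtain z where z: "z \<in> grid n" "x \<in> B \<rightarrow>\<^sub>E UNIV" "\<And>b. b \<in> B \<Longrightarrow> z b + e b = \<lfloor>real (n + s) * x b\<rfloor>"
      using s by (auto simp: mem_cube_iff)
    \<comment> \<open>The rounding error inside a cube is at most one per coordinate, which the deep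
      point \<open>e\<close> tolerates.\<close>
    define r where "r b = real (n + s) * x b - of_int (z b + e b)" for b
    have "\<bar>r b\<bar> \<le> 1" if "b \<in> B" for b
      unfolding r_def z(3)[OF that] by linarith
    then have "inD (n + s) (\<phi> (\<lambda>b. of_int (z b)) + (\<phi> (\<lambda>b. of_int (e b)) + \<phi> r))"
      using z(1) by (intro inD_add e) (simp_all add: grid_def)
    also have "\<phi> (\<lambda>b. of_int (z b)) + (\<phi> (\<lambda>b. of_int (e b)) + \<phi> r) = \<phi> (\<lambda>b. real (n + s) * x b)"
      by (simp add: \<phi>_add[symmetric] r_def)
    finally show "x \<in> K"
      using z(2) s by (subst K_iff[of "n + s"]) auto
  qed
  have upper: "K \<subseteq> (\<Union>z\<in>grid (n + s). cube n (\<lambda>b. z b - e b))" if n: "1 \<le> n" for n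
  proof
    fix x
    assume x: "x \<in> K"
    define r where "r b = of_int \<lfloor>real n * x b\<rfloor> - real n * x b" for b
    define z where "z = restrict (\<lambda>b. \<lfloor>real n * x b\<rfloor> + e b) B"
    have "\<bar>r b\<bar> \<le> 1" for b
      unfolding r_def by linarith
    then have "inD (n + s) (\<phi> (\<lambda>b. real n * x b) + (\<phi> (\<lambda>b. of_int (e b)) + \<phi> r))"
      using x n by (intro inD_add e) (simp_all add: K_iff[OF n])
    also have "\<phi> (\<lambda>b. real n * x b) + (\<phi> (\<lambda>b. of_int (e b)) + \<phi> r) = \<phi> (\<lambda>b. of_int (z b))"
      unfolding \<phi>_add[symmetric] by (rule \<phi>_cong) (simp add: r_def z_def)
    finally have "z \<in> grid (n + s)"
      by (simp add: grid_def z_def)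
    moreover have "x \<in> cube n (\<lambda>b. z b - e b)"
      using x by (simp add: mem_cube_iff[OF n] K_iff[OF n] z_def)
    ultimately show "x \<in> (\<Union>z\<in>grid (n + s). cube n (\<lambda>b. z b - e b))"
      by blast
  qed
  have upper_e: "emeasure \<mu> K \<le> ennreal (real (card (cone_pts {} (n + s))) * (1 / real n) ^ card B)" if n: "1 \<le> n" for n
  proof -
    have "emeasure \<mu> K \<le> emeasure \<mu> (\<Union>z\<in>grid (n + s). cube n (\<lambda>b. z b - e b))"
      using upper[OF n] by (rule emeasure_mono) (intro sets.finite_UN finite_grid cube_sets)
    also have "\<dots> \<le> (\<Sum>z\<in>grid (n + s). emeasure \<mu> (cube n (\<lambda>b. z b - e b)))"
      by (rule emeasure_subadditive_finite) (auto simp: finite_grid cube_sets)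
    also have "\<dots> = ennreal (real (card (cone_pts {} (n + s))) * (1 / real n) ^ card B)"
      using n by (simp add: emeasure_cube card_grid ennreal_mult'' ennreal_of_nat_eq_real_of_nat)
    finally show ?thesis .
  qed
  \<comment> \<open>Finiteness has to be established because \<open>measure\<close> is 0 on sets of
    infinite \<open>emeasure\<close>.\<close>
  have fin: "emeasure \<mu> K < top"
    using upper_e[of 1] by (rule order.strict_trans1) simp_all
  have lower_e: "ennreal (real (card (cone_pts {} n)) * (1 / real (n + s)) ^ card B) \<le> emeasure \<mu> K" for n
  proof -
    have disj: "disjoint_family_on (\<lambda>z. cube (n + s) (\<lambda>b. z b + e b)) (grid n)"
      unfolding disjoint_family_on_def
    proof (intro ballI impI)
      fix z z'
      assume z: "z \<in> grid n" "z' \<in> grid n" "z \<noteq> z'"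
      then obtain b where "b \<in> B" "z b \<noteq> z' b"
        by (metis (no_types, lifting) PiE_ext grid_def mem_Collect_eq)
      then show "cube (n + s) (\<lambda>b. z b + e b) \<inter> cube (n + s) (\<lambda>b. z' b + e b) = {}"
        using s by (auto simp: mem_cube_iff) (metis add_right_cancel)
    qed
    have "ennreal (real (card (cone_pts {} n)) * (1 / real (n + s)) ^ card B)
        = (\<Sum>z\<in>grid n. emeasure \<mu> (cube (n + s) (\<lambda>b. z b + e b)))"
      using s by (simp add: emeasure_cube card_grid ennreal_mult'' ennreal_of_nat_eq_real_of_nat)
    also have "\<dots> = emeasure \<mu> (\<Union>z\<in>grid n. cube (n + s) (\<lambda>b. z b + e b))"
      using disj by (intro sum_emeasure) (auto simp: finite_grid cube_sets)
    also have "\<dots> \<le> emeasure \<mu> K"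
      by (rule emeasure_mono[OF lower K_sets])
    finally show ?thesis .
  qed
  have eq: "emeasure \<mu> K = ennreal (measure \<mu> K)"
    using fin by (intro emeasure_eq_ennreal_measure) auto
  show ?thesis
  proof (rule that[OF s])
    show "real (card (cone_pts {} n)) * (1 / real (n + s)) ^ card B \<le> measure \<mu> K" for n
      using lower_e[of n] unfolding eq by (simp add: ennreal_le_iff)
    show "measure \<mu> K \<le> real (card (cone_pts {} (n + s))) * (1 / real n) ^ card B" if "1 \<le> n" for n
      using upper_e[OF that] unfolding eq by (simp add: ennreal_le_iff)
  qed
qed

text \<open>After inserting the lattice point bounds, both sides of the sandwich are
  \<open>p\<close> times a fixed power of a ratio that tends to 1.\<close>

lemma volume_eq: "fact (card B) * measure \<mu> K = real (\<Sum>i<card E. card (cone_pts Y i))"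
proof -
  define p d where "p = (\<Sum>i<card E. card (cone_pts Y i))" and "d = card B"
  have bounds: "real p * real n ^ d \<le> fact d * real (card (cone_pts {} (n + card E)))"
    "fact d * real (card (cone_pts {} n)) \<le> real p * real (n + d) ^ d" for n
    using card_dilate_bounds[of n, folded card_B, folded p_def d_def]
    by (metis of_nat_fact of_nat_le_iff of_nat_mult of_nat_power)+
  obtain s :: nat where s: "1 \<le> s"
    and lo: "\<And>n. real (card (cone_pts {} n)) * (1 / real (n + s)) ^ d \<le> measure \<mu> K"
    and up: "\<And>n. 1 \<le> n \<Longrightarrow> measure \<mu> K \<le> real (card (cone_pts {} (n + s))) * (1 / real n) ^ d"
    using volume_sandwich unfolding d_def by metis
  have "fact d * measure \<mu> K \<le> real p"
  proof (rule tendsto_lowerbound)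
    have "(\<lambda>n. real p * (real (n + s + d) / real n) ^ d) \<longlonglongrightarrow> real p * 1 ^ d"
    proof (intro tendsto_intros)
      have "(\<lambda>n. (real n + real s + real d) / real n) \<longlonglongrightarrow> 1"
        by real_asymp
      then show "(\<lambda>n. real (n + s + d) / real n) \<longlonglongrightarrow> 1"
        by simp
    qed
    then show "(\<lambda>n. real p * (real (n + s + d) / real n) ^ d) \<longlonglongrightarrow> real p"
      by simp
    show "\<forall>\<^sub>F n in sequentially. fact d * measure \<mu> K \<le> real p * (real (n + s + d) / real n) ^ d"
    proof (rule eventually_sequentiallyI[of 1])
      fix n :: nat
      assume n: "1 \<le> n"
      have "fact d * measure \<mu> K \<le> (fact d * real (card (cone_pts {} (n + s)))) * (1 / real n) ^ d"
        using up[OF n] by (simp add: mult.assoc)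
      also have "\<dots> \<le> (real p * real (n + s + d) ^ d) * (1 / real n) ^ d"
        by (intro mult_right_mono bounds) simp
      finally show "fact d * measure \<mu> K \<le> real p * (real (n + s + d) / real n) ^ d"
        by (simp add: power_divide)
    qed
  qed simp
  moreover have "real p \<le> fact d * measure \<mu> K"
  proof (rule tendsto_upperbound)
    have "(\<lambda>n. real p * (real n / real (n + card E + s)) ^ d) \<longlonglongrightarrow> real p * 1 ^ d"
    proof (intro tendsto_intros)
      have "(\<lambda>n. real n / (real n + real (card E) + real s)) \<longlonglongrightarrow> 1"
        by real_asymp
      then show "(\<lambda>n. real n / real (n + card E + s)) \<longlonglongrightarrow> 1"
        by simp
    qed
    then show "(\<lambda>n. real p * (real n / real (n + card E + s)) ^ d) \<longlonglongrightarrow> real p"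
      by simp
    show "\<forall>\<^sub>F n in sequentially. real p * (real n / real (n + card E + s)) ^ d \<le> fact d * measure \<mu> K"
    proof (rule always_eventually, rule allI)
      fix n
      have "real p * (real n / real (n + card E + s)) ^ d = (real p * real n ^ d) * (1 / real (n + card E + s)) ^ d"
        by (simp add: power_divide)
      also have "\<dots> \<le> (fact d * real (card (cone_pts {} (n + card E)))) * (1 / real (n + card E + s)) ^ d"
        by (intro mult_right_mono bounds) simp
      also have "\<dots> \<le> fact d * measure \<mu> K"
        using lo[of "n + card E"] by (simp add: mult.assoc)
      finally show "real p * (real n / real (n + card E + s)) ^ d \<le> fact d * measure \<mu> K" .
    qed
  qed simp
  ultimately show ?thesis
    unfolding p_def d_def by (rule antisym)
qed

end

lemma (in vertex_simplex) normalized_volume_eq: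
  "normalized_volume M \<Delta> = real (\<Sum>i<card E. card (cone_pts Y i))"
proof -
  \<comment> \<open>The choices made by \<open>SOME\<close> are only known to have their defining
    property; the computation in \<open>simplex_volume\<close> holds for every such choice.\<close>
  define v where "v = (SOME v. v \<in> \<Delta> \<inter> M)"
  define B where "B = (SOME B. lattice_basis B (sublattice_at M \<Delta> v))"
  have "\<exists>v. v \<in> \<Delta> \<inter> M"
    using E_nonempty E_subset hull_subset[of E convex] unfolding \<Delta>_def by blast
  then have v: "v \<in> \<Delta> \<inter> M"
    unfolding v_def by (rule someI_ex)
  have "\<exists>B. lattice_basis B (sublattice_at M \<Delta> v)"
    unfolding sublattice_at_def by (rule lattice_Int_subspace[OF lattice subspace_span])
  then have "lattice_basis B (sublattice_at M \<Delta> v)"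
    unfolding B_def by (rule someI_ex)
  then interpret simplex_volume M E B\<^sub>0 v B
    using v by unfold_locales auto
  have "normalized_volume M \<Delta> = fact (nat (aff_dim \<Delta>)) * measure \<mu> K"
    unfolding normalized_volume_def K_def Let_def v_def[symmetric] B_def[symmetric] by (rule refl)
  then show ?thesis
    using volume_eq by (simp add: nat_aff_dim card_B)
qed

theorem theorem1p2:
  fixes M \<Delta> :: "'a::euclidean_space set" and p :: nat
  assumes "is_lattice M"
    and "lattice_simplex M \<Delta>"
    and "IDP M \<Delta>"
    and "prime p"
    and "normalized_volume M \<Delta> = real p"
  shows "unimodal (h_star_vector M \<Delta>)"
proof -
  obtain B where B: "lattice_basis B M"
    using assms(1) by (auto simp: is_lattice_def)
  obtain V where V: "finite V" "V \<noteq> {}" "V \<subseteq> M" "\<Delta> = convex hull V"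
    and card: "int (card {v. v extreme_point_of \<Delta>}) = aff_dim \<Delta> + 1"
    using assms(2) by (auto simp: lattice_simplex_def lattice_polytope_def)
  \<comment> \<open>The generating set may contain points that are not vertices. The extreme points
    have the same hull, and their number forces affine independence.\<close>
  define E where "E = {v. v extreme_point_of \<Delta>}"
  have EV: "E \<subseteq> V"
    unfolding E_def V(4) by (rule extreme_points_of_convex_hull)
  then have fin: "finite E"
    using V(1) by (rule finite_subset)
  have hull: "\<Delta> = convex hull E"
    unfolding E_def using V
    by (intro Krein_Milman_Minkowski) (auto intro: finite_imp_compact_convex_hull)
  have "aff_dim \<Delta> = aff_dim E"
    by (subst hull) (rule aff_dim_convex_hull)
  then have "\<not> affine_dependent E"
    using card fin unfolding affine_independent_iff_card E_def[symmetric] by simp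
  moreover have "E \<noteq> {}"
    using hull V by auto
  ultimately interpret S: vertex_simplex M E B
    using B fin EV V(3) by unfold_locales auto
  have \<Delta>: "\<Delta> = S.\<Delta>"
    by (simp add: S.\<Delta>_def hull)
  \<comment> \<open>The volume is the order of the group on \<open>Box\<close>, so that this order
    is prime.\<close>
  have "real p = real (card S.Box)"
    using assms(5) unfolding \<Delta> S.normalized_volume_eq S.card_Box by simp
  then have "prime (card S.Box)"
    using assms(4) by simp
  then show ?thesis
    using S.unimodal_h_star assms(3) unfolding \<Delta> by blast
qed

end
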